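(* Let $\alpha\in(0,1)$, $T>0$, and let $(\boldsymbol E,H,\boldsymbol P)$ with $\boldsymbol E \in C(0,T; H_0(\mathrm{curl};\Omega))\cap C^1(0,T;(L^2(\Omega))^2)$, $H\in C^1(0,T;L^2(\Omega))$ and $\boldsymbol P \in C^1(0,T;(L^2(\Omega))^2)$ satisfy the weak Cole-Cole model $$\epsilon_0 \epsilon_\infty (\partial_t \boldsymbol E,\boldsymbol\chi)+(\partial_t \boldsymbol P,\boldsymbol\chi)-(H,\nabla \times \boldsymbol\chi)=0\quad \forall \boldsymbol\chi \in H_0(\mathrm{curl};\Omega),$$ $$\mu_0 (\partial_t H,\phi)+(\nabla \times \boldsymbol E,\phi)=0\quad \forall \phi \in L^2(\Omega),$$ $$\tau_0^\alpha (\partial_t^\alpha \boldsymbol P,\boldsymbol\psi)+(\boldsymbol P,\boldsymbol\psi)-\epsilon_0(\epsilon_s-\epsilon_\infty)(\boldsymbol E,\boldsymbol\psi)=0\quad \forall \boldsymbol\psi \in (L^2(\Omega))^2,$$ for $t\in(0,T)$, with initial data $\boldsymbol E(0)=\boldsymbol E_0$, $H(0)=H_0$, $\boldsymbol P(0)=\boldsymbol 0$. Assume that for almost every $\boldsymbol x\in\Omega$, $\partial_t\boldsymbol P(\boldsymbol x,\cdot)\in L^1(0,T)$ and $\partial_t^\alpha\boldsymbol P(\boldsymbol x,\cdot)\in C[0,T]$. Define $$\mathcal{E}_\alpha(t):=\tau_0^\alpha\, \big(\mathcal{I}^\alpha\|\partial_t^\alpha \boldsymbol P\|^2\big)(t)+\|\boldsymbol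 P(t)\|^2+\epsilon_0(\epsilon_s-\epsilon_\infty)\big(\epsilon_0\epsilon_\infty\|\boldsymbol E(t)\|^2+\mu_0\|H(t)\|^2\big).$$ Then $$\frac{\mathrm d}{\mathrm dt}\mathcal{E}_\alpha(t)+\tau_0^\alpha \,\eta_\alpha(t)\,\|\partial_t^\alpha \boldsymbol P(t)\|^2\leq 0,\qquad \eta_\alpha(t)=\frac{t^{\alpha-1}}{\Gamma(\alpha)},$$ and therefore $\mathcal{E}_\alpha(t_1)\leq \mathcal{E}_\alpha(t_2)$ for $t_1\geq t_2$.
   Context: $\Omega=(a,b)\times(c,d)\subset\mathbb R^2$ is a bounded rectangle. $(\cdot,\cdot)$ and $\|\cdot\|$ are the $L^2(\Omega)$ (or $(L^2(\Omega))^2$) inner product and norm. $\boldsymbol E=(E_1,E_2)^{\mathrm T}$ and $\boldsymbol P$ are $\mathbb R^2$-valued and $H$ is scalar. For a vector field $\boldsymbol v=(v_1,v_2)$, $\nabla\times\boldsymbol v=\partial_x v_2-\partial_y v_1$; for a scalar $\phi$, $\nabla\times \phi=(\partial_y \phi,-\partial_x \phi)^{\mathrm T}$. $H(\mathrm{curl};\Omega)=\{\boldsymbol v\in (L^2(\Omega))^2:\nabla\times\boldsymbol v\in L^2(\Omega)\}$ with norm $(\|\boldsymbol v\|^2+\|\nabla\times\boldsymbol v\|^2)^{1/2}$, and $H_0(\mathrm{curl};\Omega)=\{\boldsymbol v\in H(\mathrm{curl};\Omega):\boldsymbol n\times\boldsymbol v=0\text{ on }\partial\Omega\}$, with $\boldsymbol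 n$ the outward unit normal. $C^k(0,T;X)$ denotes $k$ times continuously differentiable $X$-valued functions on $[0,T]$. The physical constants $\epsilon_0,\epsilon_\infty,\epsilon_s,\mu_0,\tau_0$ are positive with $\epsilon_s>\epsilon_\infty$. The Riemann-Liouville fractional integral is $(\mathcal I^\beta u)(t)=\frac1{\Gamma(\beta)}\int_0^t (t-s)^{\beta-1}u(s)\,\mathrm ds$ for $\beta>0$, and the Caputo derivative of order $\alpha$ is $\partial_t^\alpha u=\mathcal I^{1-\alpha}(\partial_t u)$. *)

theory Defs
  imports "HOL-Analysis.Analysis"
begin

text \<open>
  Elements of Lebesgue spaces are represented by functions; two functions that agree almost
  everywhere represent the same element.
  Points of the plane and planar vectors both have type \<open>real \<times> real\<close>.
\<close>

section \<open>\<open>L\<^sup>2\<close> on a domain\<close>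

definition L2 :: "'a::euclidean_space set \<Rightarrow> ('a \<Rightarrow> 'b::euclidean_space) set" where
  "L2 \<Omega> = {u. u \<in> borel_measurable (lebesgue_on \<Omega>) \<and>
              integrable (lebesgue_on \<Omega>) (\<lambda>x. (norm (u x))\<^sup>2)}"

definition L2_inner ::
    "'a::euclidean_space set \<Rightarrow> ('a \<Rightarrow> 'b::euclidean_space) \<Rightarrow> ('a \<Rightarrow> 'b) \<Rightarrow> real" where
  "L2_inner \<Omega> u v = (\<integral>x. u x \<bullet> v x \<partial>lebesgue_on \<Omega>)"

definition L2_norm :: "'a::euclidean_space set \<Rightarrow> ('a \<Rightarrow> 'b::euclidean_space) \<Rightarrow> real" where
  "L2_norm \<Omega> u = sqrt (L2_inner \<Omega> u u)"


section \<open>The spaces \<open>H(curl)\<close> and \<open>H\<^sub>0(curl)\<close>\<close>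

definition dx :: "(real \<times> real \<Rightarrow> real) \<Rightarrow> real \<times> real \<Rightarrow> real" where
  "dx \<phi> p = frechet_derivative \<phi> (at p) (1, 0)"

definition dy :: "(real \<times> real \<Rightarrow> real) \<Rightarrow> real \<times> real \<Rightarrow> real" where
  "dy \<phi> p = frechet_derivative \<phi> (at p) (0, 1)"

fun times_cont_diff :: "nat \<Rightarrow> (real \<times> real \<Rightarrow> real) \<Rightarrow> bool" where
  "times_cont_diff 0 \<phi> \<longleftrightarrow> continuous_on UNIV \<phi>"
| "times_cont_diff (Suc k) \<phi> \<longleftrightarrow>
     (\<forall>p. \<phi> differentiable (at p)) \<and> times_cont_diff k (dx \<phi>) \<and> times_cont_diff k (dy \<phi>)"

definition smooth :: "(real \<times> real \<Rightarrow> real) \<Rightarrow> bool" where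
  "smooth \<phi> \<longleftrightarrow> (\<forall>k. times_cont_diff k \<phi>)"

definition test_function :: "(real \<times> real) set \<Rightarrow> (real \<times> real \<Rightarrow> real) \<Rightarrow> bool" where
  "test_function \<Omega> \<phi> \<longleftrightarrow> smooth \<phi> \<and> (\<exists>K. compact K \<and> K \<subseteq> \<Omega> \<and> (\<forall>p. p \<notin> K \<longrightarrow> \<phi> p = 0))"

definition scalar_curl :: "(real \<times> real \<Rightarrow> real) \<Rightarrow> real \<times> real \<Rightarrow> real \<times> real" where
  "scalar_curl \<phi> p = (dy \<phi> p, - dx \<phi> p)"

text \<open>
  The distributional meaning of \<open>w = \<partial>\<^sub>x v\<^sub>2 - \<partial>\<^sub>y v\<^sub>1\<close>: moving both derivatives to the test
  function gives \<open>\<integral> w \<phi> = \<integral> (v\<^sub>1 \<partial>\<^sub>y \<phi> - v\<^sub>2 \<partial>\<^sub>x \<phi>)\<close>.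
\<close>
definition has_weak_curl ::
    "(real \<times> real) set \<Rightarrow> (real \<times> real \<Rightarrow> real \<times> real) \<Rightarrow> (real \<times> real \<Rightarrow> real) \<Rightarrow> bool" where
  "has_weak_curl \<Omega> v w \<longleftrightarrow>
     (\<forall>\<phi>. test_function \<Omega> \<phi> \<longrightarrow> L2_inner \<Omega> w \<phi> = L2_inner \<Omega> v (scalar_curl \<phi>))"

definition Hcurl :: "(real \<times> real) set \<Rightarrow> (real \<times> real \<Rightarrow> real \<times> real) set" where
  "Hcurl \<Omega> = {v \<in> L2 \<Omega>. \<exists>w \<in> L2 \<Omega>. has_weak_curl \<Omega> v w}"

text \<open>For \<open>v \<in> Hcurl \<Omega>\<close> the weak curl is unique up to null sets; this picks a representative.\<close>
definition curl ::
    "(real \<times> real) set \<Rightarrow> (real \<times> real \<Rightarrow> real \<times> real) \<Rightarrow> real \<times> real \<Rightarrow> real" where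
  "curl \<Omega> v = (SOME w. w \<in> L2 \<Omega> \<and> has_weak_curl \<Omega> v w)"

definition Hcurl_norm :: "(real \<times> real) set \<Rightarrow> (real \<times> real \<Rightarrow> real \<times> real) \<Rightarrow> real" where
  "Hcurl_norm \<Omega> v = sqrt ((L2_norm \<Omega> v)\<^sup>2 + (L2_norm \<Omega> (curl \<Omega> v))\<^sup>2)"

text \<open>
  The tangential trace \<open>n \<times> v = n\<^sub>1 v\<^sub>2 - n\<^sub>2 v\<^sub>1\<close> of a field in \<open>H(curl)\<close> is a functional on the
  boundary, given by Green's formula
  \<open>\<langle>n \<times> v, \<phi>\<rangle> = (\<nabla> \<times> v, \<phi>) - (v, \<nabla> \<times> \<phi>)\<close>; for smooth \<open>v\<close> this is \<open>\<integral>\<^bsub>\<partial>\<Omega>\<^esub> (n \<times> v) \<phi>\<close>.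
  The functions \<open>\<phi>\<close> are smooth up to the boundary, with no condition on the boundary.
\<close>
definition tangential_trace ::
    "(real \<times> real) set \<Rightarrow> (real \<times> real \<Rightarrow> real \<times> real) \<Rightarrow> (real \<times> real \<Rightarrow> real) \<Rightarrow> real" where
  "tangential_trace \<Omega> v \<phi> = L2_inner \<Omega> (curl \<Omega> v) \<phi> - L2_inner \<Omega> v (scalar_curl \<phi>)"

definition H0curl :: "(real \<times> real) set \<Rightarrow> (real \<times> real \<Rightarrow> real \<times> real) set" where
  "H0curl \<Omega> = {v \<in> Hcurl \<Omega>. \<forall>\<phi>. smooth \<phi> \<longrightarrow> tangential_trace \<Omega> v \<phi> = 0}"


section \<open>Functions of time with values in a function space\<close>

text \<open>
  \<open>C0_into X N T u\<close> is \<open>u \<in> C(0,T;X)\<close>, where the function space \<open>X\<close> carries the norm \<open>N\<close>.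
  \<open>C1_into X N T u u'\<close> is \<open>u \<in> C\<^sup>1(0,T;X)\<close> with \<open>\<partial>\<^sub>t u = u'\<close>, the derivative being the limit of
  difference quotients in the norm of \<open>X\<close> (one-sided at the end points).
\<close>
definition C0_into ::
    "('a \<Rightarrow> 'b::real_normed_vector) set \<Rightarrow> (('a \<Rightarrow> 'b) \<Rightarrow> real) \<Rightarrow> real \<Rightarrow>
     (real \<Rightarrow> 'a \<Rightarrow> 'b) \<Rightarrow> bool" where
  "C0_into X N T u \<longleftrightarrow>
     (\<forall>t \<in> {0..T}. u t \<in> X \<and>
        ((\<lambda>s. N (\<lambda>x. u s x - u t x)) \<longlongrightarrow> 0) (at t within {0..T}))"

definition C1_into ::
    "('a \<Rightarrow> 'b::real_normed_vector) set \<Rightarrow> (('a \<Rightarrow> 'b) \<Rightarrow> real) \<Rightarrow> real \<Rightarrow>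
     (real \<Rightarrow> 'a \<Rightarrow> 'b) \<Rightarrow> (real \<Rightarrow> 'a \<Rightarrow> 'b) \<Rightarrow> bool" where
  "C1_into X N T u u' \<longleftrightarrow>
     C0_into X N T u \<and> C0_into X N T u' \<and>
     (\<forall>t \<in> {0..T}.
        ((\<lambda>s. N (\<lambda>x. (u s x - u t x) /\<^sub>R (s - t) - u' t x)) \<longlongrightarrow> 0) (at t within {0..T}))"


section \<open>Fractional calculus\<close>

definition RL_integral ::
    "real \<Rightarrow> (real \<Rightarrow> 'b::{banach, second_countable_topology}) \<Rightarrow> real \<Rightarrow> 'b" where
  "RL_integral \<beta> u t =
     (1 / Gamma \<beta>) *\<^sub>R (LINT s:{0..t}|lebesgue. ((t - s) powr (\<beta> - 1)) *\<^sub>R u s)"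

text \<open>
  The Caputo derivative of a field \<open>u\<close>, taken pointwise in space. The argument \<open>u'\<close> is (a
  representative of) the time derivative \<open>\<partial>\<^sub>t u\<close>. The representative should be jointly measurable in
  time and space: by Fubini, two such representatives give, for almost every \<open>x\<close>, the same value
  at every \<open>t\<close>.
\<close>
definition caputo ::
    "real \<Rightarrow> (real \<Rightarrow> 'a \<Rightarrow> 'b::{banach, second_countable_topology}) \<Rightarrow> real \<Rightarrow> 'a \<Rightarrow> 'b" where
  "caputo \<alpha> u' t x = RL_integral (1 - \<alpha>) (\<lambda>s. u' s x) t"

definition eta :: "real \<Rightarrow> real \<Rightarrow> real" where
  "eta \<alpha> t = t powr (\<alpha> - 1) / Gamma \<alpha>"


section \<open>The energy\<close>

text \<open>\<open>P'\<close> is the time derivative of \<open>P\<close>, and \<open>\<epsilon>\<^sub>i\<close> stands for \<open>\<epsilon>\<^sub>\<infinity>\<close>.\<close>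
definition energy ::
    "(real \<times> real) set \<Rightarrow> real \<Rightarrow> real \<Rightarrow> real \<Rightarrow> real \<Rightarrow> real \<Rightarrow> real \<Rightarrow>
     (real \<Rightarrow> real \<times> real \<Rightarrow> real \<times> real) \<Rightarrow> (real \<Rightarrow> real \<times> real \<Rightarrow> real) \<Rightarrow>
     (real \<Rightarrow> real \<times> real \<Rightarrow> real \<times> real) \<Rightarrow> (real \<Rightarrow> real \<times> real \<Rightarrow> real \<times> real) \<Rightarrow>
     real \<Rightarrow> real" where
  "energy \<Omega> \<alpha> \<epsilon>\<^sub>0 \<epsilon>\<^sub>i \<epsilon>\<^sub>s \<mu>\<^sub>0 \<tau>\<^sub>0 E H P P' t =
     \<tau>\<^sub>0 powr \<alpha> * RL_integral \<alpha> (\<lambda>s. (L2_norm \<Omega> (caputo \<alpha> P' s))\<^sup>2) t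
     + (L2_norm \<Omega> (P t))\<^sup>2
     + \<epsilon>\<^sub>0 * (\<epsilon>\<^sub>s - \<epsilon>\<^sub>i) * (\<epsilon>\<^sub>0 * \<epsilon>\<^sub>i * (L2_norm \<Omega> (E t))\<^sup>2 + \<mu>\<^sub>0 * (L2_norm \<Omega> (H t))\<^sup>2)"

end

theory Submission
  imports Defs
begin

text \<open>
  The constitutive law makes the Caputo derivative regular. Tested against \<open>\<psi>\<close>, it says that
  \<open>\<partial>\<^sub>t\<^sup>\<alpha> P\<close> agrees almost everywhere with \<open>w = (\<kappa> E - P) / \<tau>\<^sub>0\<^sup>\<alpha>\<close>, where
  \<open>\<kappa> = \<epsilon>\<^sub>0 (\<epsilon>\<^sub>s - \<epsilon>\<^sub>i)\<close>, and the right-hand side is continuously differentiable into \<open>L\<^sup>2\<close>. Moreover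
  \<open>w(0) = 0\<close>, because the fractional integral \<open>I\<^sup>1\<^sup>-\<^sup>\<alpha> P'\<close> vanishes at \<open>0\<close>. So the fractional part of
  the energy is \<open>I\<^sup>\<alpha> \<parallel>w\<parallel>\<^sup>2\<close> with a classical time derivative \<open>I\<^sup>\<alpha> (\<parallel>w\<parallel>\<^sup>2)'\<close>.

  Testing the two Maxwell equations with \<open>E\<close> and \<open>H\<close> cancels the curl terms and leaves
  \<open>\<E>' = \<tau>\<^sub>0\<^sup>\<alpha> (I\<^sup>\<alpha> (\<parallel>w\<parallel>\<^sup>2)' - 2 (P', w))\<close>. Inverting the Caputo derivative, \<open>P' = I\<^sup>\<alpha> w'\<close>, turns
  the bracket at time \<open>t\<close> into
  \<open>I\<^sup>\<alpha> m' (t)\<close> with \<open>m(s) = \<parallel>w(t) - w(s)\<parallel>\<^sup>2\<close>. Since \<open>m \<ge> 0\<close> vanishes at \<open>s = t\<close> and the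
  kernel \<open>(t - s)\<^sup>\<alpha>\<^sup>-\<^sup>1\<close> increases in \<open>s\<close>, integration by parts gives
  \<open>I\<^sup>\<alpha> m' (t) \<le> - \<eta>\<^sub>\<alpha>(t) m(0) = - \<eta>\<^sub>\<alpha>(t) \<parallel>w(t)\<parallel>\<^sup>2\<close>, which is the claim
  (\<open>RL_integral_deriv_le\<close>, \<open>L2_fractional_chain_inequality\<close>).

  The analytic content lies in \<open>RL_integral_has_derivative\<close> (differentiation of \<open>I\<^sup>\<alpha> q\<close> when
  \<open>q(0) = 0\<close>), \<open>RL_integral_semigroup\<close> (\<open>I\<^sup>\<alpha> I\<^sup>1\<^sup>-\<^sup>\<alpha> = I\<^sup>1\<close>), and
  \<open>L2_inner_RL_integral\<close>: the Caputo derivative is a pointwise integral in time, and Fubini's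
  theorem lets it be tested in space, so that the whole argument runs on the scalar functions
  \<open>t \<mapsto> (u(t), \<psi>)\<close>.
\<close>

section \<open>The Riemann-Liouville integral as a convolution\<close>

text \<open>
  The Riemann-Liouville kernel \<open>r\<^sup>\<beta>\<^sup>-\<^sup>1 / \<Gamma>(\<beta>)\<close>, cut off at \<open>T\<close> to make it integrable. The cut-off
  is invisible as long as only times up to \<open>T\<close> are considered.
\<close>
definition frac_kernel :: "real \<Rightarrow> real \<Rightarrow> real \<Rightarrow> real" where
  "frac_kernel \<beta> T r = indicator {0<..T} r * r powr (\<beta> - 1) / Gamma \<beta>"

lemma frac_kernel_nonneg: "0 < \<beta> \<Longrightarrow> 0 \<le> frac_kernel \<beta> T r"
  by (simp add: frac_kernel_def Gamma_real_pos less_imp_le)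

lemma frac_kernel_measurable [measurable]: "frac_kernel \<beta> T \<in> borel_measurable borel"
  unfolding frac_kernel_def by measurable

lemma frac_kernel_integrable:
  assumes "0 < \<beta>" "0 \<le> T"
  shows "integrable lborel (frac_kernel \<beta> T)"
proof -
  have "(\<lambda>r. r powr (\<beta> - 1)) absolutely_integrable_on {0<..T}"
    using assms by (intro nonnegative_absolutely_integrable_1 integrable_on_powr_from_0') auto
  then have "integrable lebesgue (\<lambda>r. indicator {0<..T} r *\<^sub>R r powr (\<beta> - 1))"
    by (simp add: set_integrable_def)
  then have "integrable lborel (\<lambda>r. indicator {0<..T} r *\<^sub>R r powr (\<beta> - 1))"
    by (subst (asm) integrable_completion) auto
  then show ?thesis unfolding frac_kernel_def by auto
qed

text \<open>
  Extension by \<open>0\<close> moves the time dependence of \<open>\<integral>\<^sub>0\<^sup>t\<close> out of the domain of integration and into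
  the integrand, where dominated convergence can handle it.
\<close>
definition zero_ext :: "real \<Rightarrow> (real \<Rightarrow> real) \<Rightarrow> real \<Rightarrow> real" where
  "zero_ext T u s = indicator {0..T} s * u s"

lemma zero_ext_measurable:
  "continuous_on {0..T} u \<Longrightarrow> zero_ext T u \<in> borel_measurable borel"
  unfolding zero_ext_def[abs_def]
  using borel_measurable_continuous_on_indicator[of "{0..T}" u] by (simp)

lemma zero_ext_bounded:
  assumes "continuous_on {0..T} u"
  obtains B where "0 \<le> B" "\<And>s. \<bar>zero_ext T u s\<bar> \<le> B"
proof -
  have "bounded (u ` {0..T})"
    by (intro compact_imp_bounded compact_continuous_image assms) auto
  then obtain B where "B > 0" "\<forall>y\<in>u ` {0..T}. norm y \<le> B"
    unfolding bounded_pos by auto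
  with that[of B] show ?thesis by (auto simp: zero_ext_def indicator_def)
qed

lemma RL_integral_convolution:
  assumes u: "zero_ext T u \<in> borel_measurable borel" and t: "t \<in> {0..T}"
  shows "RL_integral \<beta> u t = (\<integral>r. frac_kernel \<beta> T r * zero_ext T u (t - r) \<partial>lborel)"
proof -
  let ?f = "\<lambda>s. indicator {0..t} s * ((t - s) powr (\<beta> - 1) * zero_ext T u s)"
  have "(LINT s:{0..t}|lebesgue. ((t - s) powr (\<beta> - 1)) *\<^sub>R u s) = (\<integral>s. ?f s \<partial>lebesgue)"
    unfolding set_lebesgue_integral_def using t
    by (intro Bochner_Integration.integral_cong) (auto simp: zero_ext_def indicator_def)
  also have "\<dots> = (\<integral>s. ?f s \<partial>lborel)"
    using u by (intro integral_completion) measurable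
  also have "\<dots> = (\<integral>r. ?f (t - r) \<partial>lborel)"
    using lborel_integral_real_affine[of "-1" ?f t] by simp
  finally have "RL_integral \<beta> u t = (\<integral>r. 1 / Gamma \<beta> * ?f (t - r) \<partial>lborel)"
    by (simp add: RL_integral_def)
  also have "\<dots> = (\<integral>r. frac_kernel \<beta> T r * zero_ext T u (t - r) \<partial>lborel)"
    using t by (intro Bochner_Integration.integral_cong)
      (auto simp: zero_ext_def frac_kernel_def indicator_def)
  finally show ?thesis .
qed

lemma convolution_integrable:
  assumes "0 < \<beta>" "0 \<le> T" "continuous_on {0..T} u"
  shows "integrable lborel (\<lambda>r. frac_kernel \<beta> T r * zero_ext T u (t - r))"
proof -
  obtain B where B: "\<And>s. \<bar>zero_ext T u s\<bar> \<le> B" using zero_ext_bounded[OF assms(3)] by metis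
  note [measurable] = zero_ext_measurable[OF assms(3)]
  show ?thesis
  proof (rule Bochner_Integration.integrable_bound)
    show "integrable lborel (\<lambda>r. frac_kernel \<beta> T r * B)" using frac_kernel_integrable[OF assms(1,2)] by simp
    show "AE r in lborel. norm (frac_kernel \<beta> T r * zero_ext T u (t - r)) \<le> norm (frac_kernel \<beta> T r * B)"
      using B order_trans[OF abs_ge_zero B] by (auto simp: abs_mult intro!: mult_left_mono)
  qed measurable
qed

text \<open>
  Dominated convergence: the extension by \<open>0\<close> may jump at \<open>0\<close>, but for the shifted function
  \<open>r \<mapsto> u (t - r)\<close> that is the single point \<open>r = t\<close>.
\<close>
lemma continuous_on_RL_integral:
  fixes u :: "real \<Rightarrow> real"
  assumes "0 < \<beta>" "0 \<le> T" "continuous_on {0..T} u"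
  shows "continuous_on {0..T} (RL_integral \<beta> u)"
  unfolding continuous_on_sequentially
proof (intro ballI allI impI)
  fix X :: "nat \<Rightarrow> real" and t
  assume t: "t \<in> {0..T}" and "(\<forall>n. X n \<in> {0..T}) \<and> X \<longlonglongrightarrow> t"
  then have XT: "\<And>n. X n \<in> {0..T}" and X: "X \<longlonglongrightarrow> t" by auto
  obtain B where B: "\<And>s. \<bar>zero_ext T u s\<bar> \<le> B" using zero_ext_bounded[OF assms(3)] by metis
  note [measurable] = zero_ext_measurable[OF assms(3)]
  have "(\<lambda>n. \<integral>r. frac_kernel \<beta> T r * zero_ext T u (X n - r) \<partial>lborel)
          \<longlonglongrightarrow> (\<integral>r. frac_kernel \<beta> T r * zero_ext T u (t - r) \<partial>lborel)"
  proof (rule integral_dominated_convergence)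
    show "integrable lborel (\<lambda>r. frac_kernel \<beta> T r * B)" using frac_kernel_integrable[OF assms(1,2)] by simp
    show "AE r in lborel. norm (frac_kernel \<beta> T r * zero_ext T u (X n - r)) \<le> frac_kernel \<beta> T r * B" for n
      using B frac_kernel_nonneg[OF assms(1)] by (auto simp: abs_mult intro!: mult_left_mono)
    show "AE r in lborel. (\<lambda>n. frac_kernel \<beta> T r * zero_ext T u (X n - r))
            \<longlonglongrightarrow> frac_kernel \<beta> T r * zero_ext T u (t - r)"
      using AE_lborel_singleton[of t]
    proof eventually_elim
      case (elim r)
      have Xr: "(\<lambda>n. X n - r) \<longlonglongrightarrow> t - r" by (intro tendsto_intros X)
      show ?case
      proof (cases "r > 0")
        case True
        have "(\<lambda>n. zero_ext T u (X n - r)) \<longlonglongrightarrow> zero_ext T u (t - r)"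
        proof (cases "r < t")
          case True
          have "eventually (\<lambda>n. X n - r > 0) sequentially"
            using order_tendstoD(1)[OF Xr, of 0] True by simp
          then have ev: "eventually (\<lambda>n. X n - r \<in> {0..T}) sequentially"
            by eventually_elim (use XT \<open>r > 0\<close> in \<open>auto intro: order_trans\<close>, smt (verit) XT atLeastAtMost_iff)
          have "(\<lambda>n. u (X n - r)) \<longlonglongrightarrow> u (t - r)"
            using assms(3) t True \<open>r > 0\<close> ev Xr
            by (intro continuous_on_tendsto_compose[OF assms(3) Xr]) auto
          moreover have "eventually (\<lambda>n. zero_ext T u (X n - r) = u (X n - r)) sequentially"
            using ev by eventually_elim (simp add: zero_ext_def)
          moreover have "zero_ext T u (t - r) = u (t - r)"
            using t True \<open>r > 0\<close> by (simp add: zero_ext_def)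
          ultimately show ?thesis by (simp add: tendsto_cong)
        next
          case False
          then have "eventually (\<lambda>n. X n - r < 0) sequentially"
            using order_tendstoD(2)[OF Xr, of 0] elim by simp
          then have "eventually (\<lambda>n. zero_ext T u (X n - r) = 0) sequentially"
            by eventually_elim (simp add: zero_ext_def)
          moreover have "zero_ext T u (t - r) = 0" using False elim by (simp add: zero_ext_def)
          ultimately show ?thesis by (simp add: tendsto_eventually)
        qed
        then show ?thesis by (intro tendsto_intros)
      qed (simp add: frac_kernel_def)
    qed
  qed measurable
  then show "(RL_integral \<beta> u \<circ> X) \<longlonglongrightarrow> RL_integral \<beta> u t"
    using RL_integral_convolution[OF zero_ext_measurable[OF assms(3)]] XT t by (simp add: o_def)
qed

lemma RL_integral_0: "RL_integral \<beta> u 0 = 0"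
proof -
  have "(\<lambda>s::real. indicat_real {0..0} s *\<^sub>R ((0 - s) powr (\<beta> - 1)) *\<^sub>R u s) = (\<lambda>s. 0)"
    by (auto simp: indicator_def)
  then show ?thesis unfolding RL_integral_def set_lebesgue_integral_def by simp
qed

text \<open>
  The hypothesis \<open>q 0 = 0\<close> makes the extension by \<open>0\<close> Lipschitz continuous on the half-line up to
  \<open>T\<close>, with a kink only at \<open>0\<close>. The difference quotients of the convolution are therefore dominated
  by a multiple of the kernel and converge for all \<open>r \<noteq> t\<close>. Without the hypothesis there would be
  an additional term \<open>\<eta>\<^sub>\<beta>(t) q(0)\<close>.
\<close>
lemma RL_integral_has_derivative:
  assumes \<beta>: "0 < \<beta>" and t: "t \<in> {0<..<T}"
    and der: "\<And>s. s \<in> {0..T} \<Longrightarrow> (q has_real_derivative q' s) (at s within {0..T})"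
    and cont: "continuous_on {0..T} q'" and q0: "q 0 = 0"
  shows "(RL_integral \<beta> q has_real_derivative RL_integral \<beta> q' t) (at t)"
proof -
  have T: "0 \<le> T" using t by auto
  have contq: "continuous_on {0..T} q"
    using der by (meson DERIV_continuous continuous_on_eq_continuous_within)
  note [measurable] = zero_ext_measurable[OF cont] zero_ext_measurable[OF contq]
  obtain B where B: "\<And>s. \<bar>zero_ext T q' s\<bar> \<le> B" and B0: "0 \<le> B"
    using zero_ext_bounded[OF cont] by metis
  have lip1: "\<bar>q x - q y\<bar> \<le> B * \<bar>x - y\<bar>" if "x \<in> {0..T}" "y \<in> {0..T}" for x y
  proof -
    have "norm (q' z) \<le> B" if "z \<in> {0..T}" for z
      using B[of z] that by (simp add: zero_ext_def)
    then show ?thesis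
      using field_differentiable_bound[of "{0..T}" q q' B x y] der that by simp
  qed
  have lip: "\<bar>zero_ext T q x - zero_ext T q y\<bar> \<le> B * \<bar>x - y\<bar>" if "x \<le> T" "y \<le> T" for x y
  proof -
    have eq: "zero_ext T q z = q (max 0 z)" if "z \<le> T" for z
      using that q0 T by (auto simp: zero_ext_def indicator_def max_def)
    have "\<bar>q (max 0 x) - q (max 0 y)\<bar> \<le> B * \<bar>max 0 x - max 0 y\<bar>"
      using that T by (intro lip1) auto
    also have "\<dots> \<le> B * \<bar>x - y\<bar>" using B0 by (intro mult_left_mono) auto
    finally show ?thesis using eq that by simp
  qed
  define D where "D \<tau> r = (zero_ext T q (\<tau> - r) - zero_ext T q (t - r)) / (\<tau> - t)" for \<tau> r
  have "((\<lambda>\<tau>. (RL_integral \<beta> q \<tau> - RL_integral \<beta> q t) / (\<tau> - t)) \<longlongrightarrow> RL_integral \<beta> q' t)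
          (at t within {0<..<T})"
    unfolding tendsto_at_iff_sequentially
  proof (intro allI impI)
    fix X :: "nat \<Rightarrow> real" assume X0: "\<forall>n. X n \<in> {0<..<T} - {t}" and X: "X \<longlonglongrightarrow> t"
    from X0 have XT: "X n \<in> {0<..<T}" "X n \<noteq> t" for n by auto
    have "(\<lambda>n. \<integral>r. frac_kernel \<beta> T r * D (X n) r \<partial>lborel)
        \<longlonglongrightarrow> (\<integral>r. frac_kernel \<beta> T r * zero_ext T q' (t - r) \<partial>lborel)"
    proof (rule integral_dominated_convergence)
      show "integrable lborel (\<lambda>r. frac_kernel \<beta> T r * B)" using frac_kernel_integrable[OF \<beta> T] by simp
      show "AE r in lborel. norm (frac_kernel \<beta> T r * D (X n) r) \<le> frac_kernel \<beta> T r * B" for n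
      proof (rule AE_I2)
        fix r
        show "norm (frac_kernel \<beta> T r * D (X n) r) \<le> frac_kernel \<beta> T r * B"
        proof (cases "r > 0")
          case True
          have "\<bar>zero_ext T q (X n - r) - zero_ext T q (t - r)\<bar> \<le> B * \<bar>X n - t\<bar>"
            using lip[of "X n - r" "t - r"] XT[of n] t True by simp
          then have "\<bar>D (X n) r\<bar> \<le> B"
            using XT[of n] by (simp add: D_def pos_divide_le_eq)
          then show ?thesis using frac_kernel_nonneg[OF \<beta>] by (auto simp: abs_mult intro!: mult_left_mono)
        qed (simp add: frac_kernel_def)
      qed
      show "AE r in lborel. (\<lambda>n. frac_kernel \<beta> T r * D (X n) r)
              \<longlonglongrightarrow> frac_kernel \<beta> T r * zero_ext T q' (t - r)"
        using AE_lborel_singleton[of t]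
      proof eventually_elim
        case (elim r)
        show ?case
        proof (cases "r > 0")
          case True
          have "(zero_ext T q has_real_derivative zero_ext T q' (t - r)) (at (t - r))"
          proof (cases "r < t")
            case True
            then have z: "t - r \<in> {0<..<T}" using \<open>r > 0\<close> t by auto
            have "(q has_real_derivative q' (t - r)) (at (t - r) within {0<..<T})"
              using der z by (meson DERIV_subset atLeastAtMost_iff greaterThanLessThan_iff
                greaterThanLessThan_subseteq_atLeastAtMost_iff less_imp_le order_refl)
            then have "(q has_real_derivative q' (t - r)) (at (t - r))"
              by (simp add: at_within_open[OF z])
            then have "(zero_ext T q has_real_derivative q' (t - r)) (at (t - r))"
              by (rule has_field_derivative_transform_within_open[of _ _ _ "{0<..<T}"])
                (use z in \<open>auto simp: zero_ext_def\<close>)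
            then show ?thesis using z by (simp add: zero_ext_def)
          next
            case False
            then have z: "t - r \<in> {..<0}" using elim by auto
            have "(zero_ext T q has_real_derivative 0) (at (t - r))"
              by (rule has_field_derivative_transform_within_open[of "\<lambda>_. 0" _ _ "{..<0}"])
                (use z in \<open>auto simp: zero_ext_def\<close>)
            then show ?thesis using z by (simp add: zero_ext_def)
          qed
          then have "(\<lambda>n. (zero_ext T q ((t - r) + (X n - t)) - zero_ext T q (t - r)) / (X n - t))
              \<longlonglongrightarrow> zero_ext T q' (t - r)"
            unfolding DERIV_def
          proof (rule filterlim_compose)
            show "filterlim (\<lambda>n. X n - t) (at 0) sequentially"
              using tendsto_diff[OF X tendsto_const[of t]] XT by (simp add: filterlim_at)
          qed
          then have "(\<lambda>n. D (X n) r) \<longlonglongrightarrow> zero_ext T q' (t - r)"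
            by (simp add: D_def algebra_simps)
          then show ?thesis by (intro tendsto_intros)
        qed (simp add: frac_kernel_def)
      qed
    qed (auto simp: D_def)
    moreover have "(\<integral>r. frac_kernel \<beta> T r * D (X n) r \<partial>lborel)
        = (RL_integral \<beta> q (X n) - RL_integral \<beta> q t) / (X n - t)" for n
    proof -
      have "(\<integral>r. frac_kernel \<beta> T r * D (X n) r \<partial>lborel)
        = (\<integral>r. (frac_kernel \<beta> T r * zero_ext T q (X n - r) - frac_kernel \<beta> T r * zero_ext T q (t - r)) / (X n - t) \<partial>lborel)"
        by (simp add: D_def algebra_simps)
      also have "\<dots> = (RL_integral \<beta> q (X n) - RL_integral \<beta> q t) / (X n - t)"
        using XT[of n] t
        by (simp add: RL_integral_convolution[OF zero_ext_measurable[OF contq]]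
            Bochner_Integration.integral_diff[OF convolution_integrable[OF \<beta> T contq] convolution_integrable[OF \<beta> T contq]])
      finally show ?thesis .
    qed
    ultimately show "((\<lambda>\<tau>. (RL_integral \<beta> q \<tau> - RL_integral \<beta> q t) / (\<tau> - t)) \<circ> X)
        \<longlonglongrightarrow> RL_integral \<beta> q' t"
      using t by (simp add: RL_integral_convolution[OF zero_ext_measurable[OF cont]] o_def)
  qed
  then show ?thesis
    unfolding has_field_derivative_iff at_within_open[OF t open_greaterThanLessThan] .
qed

section \<open>Monotonicity and inversion of the Riemann-Liouville integral\<close>

text \<open>
  The end point \<open>s = t\<close> may be left out since the kernel takes the value \<open>0 powr (\<beta> - 1) = 0\<close>
  there.
\<close>
lemma RL_integral_cong:
  assumes "\<And>s. s \<in> {0..<t} \<Longrightarrow> u s = v s"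
  shows "RL_integral \<beta> u t = RL_integral \<beta> v t"
proof -
  have "(\<lambda>s. indicat_real {0..t} s *\<^sub>R ((t - s) powr (\<beta> - 1)) *\<^sub>R u s)
      = (\<lambda>s. indicat_real {0..t} s *\<^sub>R ((t - s) powr (\<beta> - 1)) *\<^sub>R v s)"
  proof
    fix s
    show "indicat_real {0..t} s *\<^sub>R ((t - s) powr (\<beta> - 1)) *\<^sub>R u s
        = indicat_real {0..t} s *\<^sub>R ((t - s) powr (\<beta> - 1)) *\<^sub>R v s"
      using assms[of s] by (cases "s = t") (auto simp: indicator_def)
  qed
  then show ?thesis unfolding RL_integral_def set_lebesgue_integral_def by simp
qed

lemma RL_integral_has_integral:
  fixes u :: "real \<Rightarrow> real"
  assumes "0 < \<beta>" "0 \<le> t" "continuous_on {0..t} u"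
  shows "((\<lambda>s. (t - s) powr (\<beta> - 1) * u s) has_integral Gamma \<beta> * RL_integral \<beta> u t) {0..t}"
proof -
  let ?f = "\<lambda>s. Gamma \<beta> * (frac_kernel \<beta> t (t - s) * zero_ext t u s)"
  have G: "Gamma \<beta> \<noteq> 0" using Gamma_real_pos[OF assms(1)] by linarith
  have eq: "?f s = indicator {0..t} s *\<^sub>R ((t - s) powr (\<beta> - 1) * u s)" for s
    using G by (auto simp: frac_kernel_def zero_ext_def indicator_def)
  have "integrable lborel (\<lambda>s. frac_kernel \<beta> t (t - s) * zero_ext t u s)"
    using lborel_integrable_real_affine[OF convolution_integrable[OF assms, of t], of "-1" t] by simp
  then have "integrable lborel ?f" by simp
  then have "set_integrable lborel {0..t} (\<lambda>s. (t - s) powr (\<beta> - 1) * u s)"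
    unfolding eq set_integrable_def .
  note * = set_borel_integral_eq_integral[OF this]
  have "(LBINT s:{0..t}. (t - s) powr (\<beta> - 1) * u s) = (\<integral>s. ?f s \<partial>lborel)"
    unfolding eq set_lebesgue_integral_def ..
  also have "\<dots> = Gamma \<beta> * (\<integral>s. frac_kernel \<beta> t (t - s) * zero_ext t u s \<partial>lborel)" by simp
  also have "(\<integral>s. frac_kernel \<beta> t (t - s) * zero_ext t u s \<partial>lborel) = RL_integral \<beta> u t"
    using lborel_integral_real_affine[of "-1" "\<lambda>s. frac_kernel \<beta> t (t - s) * zero_ext t u s" t]
      RL_integral_convolution[OF zero_ext_measurable[OF assms(3)], of t \<beta>] assms(2) by simp
  finally show ?thesis using * by (simp add: has_integral_iff)
qed

lemma RL_integral_lincomb: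
  fixes u v :: "real \<Rightarrow> real"
  assumes "0 < \<beta>" "0 \<le> t" "continuous_on {0..t} u" "continuous_on {0..t} v"
  shows "RL_integral \<beta> (\<lambda>s. a * u s + b * v s) t = a * RL_integral \<beta> u t + b * RL_integral \<beta> v t"
proof -
  let ?k = "\<lambda>s. (t - s) powr (\<beta> - 1)"
  have "((\<lambda>s. a * (?k s * u s) + b * (?k s * v s)) has_integral
      a * (Gamma \<beta> * RL_integral \<beta> u t) + b * (Gamma \<beta> * RL_integral \<beta> v t)) {0..t}"
    by (intro has_integral_add has_integral_mult_right RL_integral_has_integral assms)
  moreover have "(\<lambda>s. a * (?k s * u s) + b * (?k s * v s)) = (\<lambda>s. ?k s * (a * u s + b * v s))"
    by (simp add: algebra_simps)
  ultimately have "((\<lambda>s. ?k s * (a * u s + b * v s)) has_integral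
      a * (Gamma \<beta> * RL_integral \<beta> u t) + b * (Gamma \<beta> * RL_integral \<beta> v t)) {0..t}"
    by simp
  moreover have "((\<lambda>s. ?k s * (a * u s + b * v s)) has_integral
      Gamma \<beta> * RL_integral \<beta> (\<lambda>s. a * u s + b * v s) t) {0..t}"
    by (intro RL_integral_has_integral continuous_intros assms)
  ultimately have "a * (Gamma \<beta> * RL_integral \<beta> u t) + b * (Gamma \<beta> * RL_integral \<beta> v t)
      = Gamma \<beta> * RL_integral \<beta> (\<lambda>s. a * u s + b * v s) t"
    by (rule has_integral_unique)
  then have "Gamma \<beta> * RL_integral \<beta> (\<lambda>s. a * u s + b * v s) t
      = Gamma \<beta> * (a * RL_integral \<beta> u t + b * RL_integral \<beta> v t)"
    by (simp add: algebra_simps)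
  then show ?thesis using Gamma_real_pos[OF assms(1)] by simp
qed

text \<open>
  Integration by parts against the increasing kernel \<open>(t - s)\<^sup>\<alpha>\<^sup>-\<^sup>1\<close>. With
  \<open>F s = (t - s)\<^sup>\<alpha>\<^sup>-\<^sup>1 m s\<close>, the derivative \<open>F'\<close> exceeds \<open>(t - s)\<^sup>\<alpha>\<^sup>-\<^sup>1 m' s\<close> by the nonnegative term
  \<open>(1 - \<alpha>) (t - s)\<^sup>\<alpha>\<^sup>-\<^sup>2 m s\<close>. The boundary term at \<open>s = t\<close> vanishes because \<open>m t = 0\<close> and \<open>m\<close> is
  Lipschitz, so that \<open>F s = O((t - s)\<^sup>\<alpha>)\<close>.
\<close>
lemma RL_integral_deriv_le:
  assumes \<alpha>: "0 < \<alpha>" "\<alpha> \<le> 1" and t: "0 < t"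
    and der: "\<And>s. s \<in> {0..t} \<Longrightarrow> (m has_real_derivative m' s) (at s within {0..t})"
    and cont: "continuous_on {0..t} m'"
    and nonneg: "\<And>s. s \<in> {0..t} \<Longrightarrow> 0 \<le> m s" and mt: "m t = 0"
  shows "RL_integral \<alpha> m' t \<le> - eta \<alpha> t * m 0"
proof -
  define F where "F s = (t - s) powr (\<alpha> - 1) * m s" for s
  define F' where "F' s = (1 - \<alpha>) * (t - s) powr (\<alpha> - 2) * m s + (t - s) powr (\<alpha> - 1) * m' s" for s
  have contm: "continuous_on {0..t} m"
    using der by (meson DERIV_continuous continuous_on_eq_continuous_within)
  obtain B where B: "\<And>s. \<bar>zero_ext t m' s\<bar> \<le> B" using zero_ext_bounded[OF cont] by metis
  have mb: "\<bar>m s\<bar> \<le> B * (t - s)" if "s \<in> {0..t}" for s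
  proof -
    have "norm (m' z) \<le> B" if "z \<in> {0..t}" for z
      using B[of z] that by (simp add: zero_ext_def)
    then show ?thesis
      using field_differentiable_bound[of "{0..t}" m m' B s t] der that mt t by simp
  qed
  have "continuous_on {0..t} F"
    unfolding continuous_on_eq_continuous_within
  proof
    fix s assume s: "s \<in> {0..t}"
    show "continuous (at s within {0..t}) F"
    proof (cases "s = t")
      case False
      have "continuous (at s within {0..t}) m"
        using contm s by (simp add: continuous_on_eq_continuous_within)
      then show ?thesis using False s unfolding F_def
        by (intro continuous_intros) auto
    next
      case True
      have "((\<lambda>s. B * (t - s) powr \<alpha>) \<longlongrightarrow> B * 0 powr \<alpha>) (at t within {0..t})"
      proof (intro tendsto_mult tendsto_const tendsto_powr2)
        show "((\<lambda>s. t - s) \<longlongrightarrow> 0) (at t within {0..t})"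
          using tendsto_diff[OF tendsto_const[of t] tendsto_ident_at[of t "{0..t}"]] by simp
        show "eventually (\<lambda>s. 0 \<le> t - s) (at t within {0..t})"
          by (auto simp: eventually_at_filter)
      qed (use \<alpha> in auto)
      then have lim: "((\<lambda>s. B * (t - s) powr \<alpha>) \<longlongrightarrow> 0) (at t within {0..t})" by simp
      have "(F \<longlongrightarrow> 0) (at t within {0..t})"
      proof (rule Lim_null_comparison[OF _ lim])
        have "norm (F s) \<le> B * (t - s) powr \<alpha>" if "s \<in> {0..t}" "s \<noteq> t" for s
        proof -
          have "norm (F s) \<le> (t - s) powr (\<alpha> - 1) * (B * (t - s))"
            using mb[OF that(1)] by (auto simp: F_def abs_mult intro!: mult_left_mono)
          also have "\<dots> = B * (t - s) powr \<alpha>"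
            using that by (simp add: powr_diff)
          finally show ?thesis .
        qed
        then show "eventually (\<lambda>s. norm (F s) \<le> B * (t - s) powr \<alpha>) (at t within {0..t})"
          by (auto simp: eventually_at_filter)
      qed
      then show ?thesis using True mt by (simp add: continuous_within F_def)
    qed
  qed
  moreover have "(F has_vector_derivative F' s) (at s)" if "s \<in> {0<..<t}" for s
  proof -
    have "(m has_real_derivative m' s) (at s within {0<..<t})"
      using der that by (meson DERIV_subset atLeastAtMost_iff greaterThanLessThan_iff
         greaterThanLessThan_subseteq_atLeastAtMost_iff less_imp_le order_refl)
    then have m: "(m has_real_derivative m' s) (at s)" by (simp add: at_within_open[OF that])
    have "(F has_real_derivative
        ((\<alpha> - 1) * (t - s) powr (\<alpha> - 1 - 1) * (-1)) * m s + m' s * (t - s) powr (\<alpha> - 1)) (at s)"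
      unfolding F_def
    proof (rule DERIV_mult[OF _ m])
      show "((\<lambda>s. (t - s) powr (\<alpha> - 1)) has_real_derivative
          (\<alpha> - 1) * (t - s) powr (\<alpha> - 1 - 1) * (-1)) (at s)"
        using that by (intro DERIV_fun_powr[of "\<lambda>s. t - s" "-1", simplified] derivative_eq_intros)
           auto
    qed
    also have "((\<alpha> - 1) * (t - s) powr (\<alpha> - 1 - 1) * (-1)) * m s + m' s * (t - s) powr (\<alpha> - 1) = F' s"
      by (simp add: F'_def algebra_simps)
    finally show ?thesis by (simp add: has_real_derivative_iff_has_vector_derivative)
  qed
  ultimately have "(F' has_integral F t - F 0) {0..t}"
    using t by (intro fundamental_theorem_of_calculus_interior) auto
  moreover have "((\<lambda>s. (t - s) powr (\<alpha> - 1) * m' s) has_integral Gamma \<alpha> * RL_integral \<alpha> m' t) {0..t}"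
    using RL_integral_has_integral[OF \<alpha>(1) _ cont] t by simp
  moreover have "(t - s) powr (\<alpha> - 1) * m' s \<le> F' s" if "s \<in> {0..t}" for s
    using nonneg[OF that] \<alpha> by (simp add: F'_def)
  ultimately have "Gamma \<alpha> * RL_integral \<alpha> m' t \<le> F t - F 0"
    by (meson has_integral_le)
  then have "Gamma \<alpha> * RL_integral \<alpha> m' t \<le> - (t powr (\<alpha> - 1) * m 0)" by (simp add: F_def)
  then have "RL_integral \<alpha> m' t \<le> - (t powr (\<alpha> - 1) * m 0) / Gamma \<alpha>"
    using Gamma_real_pos[OF \<alpha>(1)] by (simp add: field_simps)
  then show ?thesis by (simp add: eta_def)
qed

text \<open>
  After the substitution \<open>s = r + (t - r) u\<close> all powers of \<open>t - r\<close> cancel, and what remains is the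
  Beta integral \<open>B(1 - \<alpha>, \<alpha>) = \<Gamma>(1 - \<alpha>) \<Gamma>(\<alpha>)\<close>.
\<close>
lemma frac_kernel_convolution:
  assumes \<alpha>: "0 < \<alpha>" "\<alpha> < 1" and r: "0 \<le> r" "r < t"
  shows "has_bochner_integral lborel
    (\<lambda>s. frac_kernel \<alpha> t (t - s) * frac_kernel (1 - \<alpha>) t (s - r)) 1"
proof -
  let ?f = "\<lambda>s. frac_kernel \<alpha> t (t - s) * frac_kernel (1 - \<alpha>) t (s - r)"
  let ?g = "\<lambda>u. indicator {0..1} u *\<^sub>R (u powr ((1 - \<alpha>) - 1) * (1 - u) powr (\<alpha> - 1))"
  let ?c = "1 / (Gamma \<alpha> * Gamma (1 - \<alpha>))"
  have G: "Gamma \<alpha> > 0" "Gamma (1 - \<alpha>) > 0" using \<alpha> by (auto intro: Gamma_real_pos)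
  have eq: "(t - r) * ?f (r + (t - r) * u) = ?c * ?g u" for u
  proof (cases "0 < u \<and> u < 1")
    case True
    then have "(t - r) * (1 - u) \<le> t * 1" "(t - r) * u \<le> t * 1"
      using r True by (intro mult_mono; simp)+
    moreover have "(t - r) * (1 - u) > 0" "(t - r) * u > 0" using True r by auto
    moreover have "t - (r + (t - r) * u) = (t - r) * (1 - u)" by (simp add: algebra_simps)
    ultimately have "?f (r + (t - r) * u)
        = ((t - r) * (1 - u)) powr (\<alpha> - 1) * ((t - r) * u) powr (- \<alpha>) * ?c"
      by (simp add: frac_kernel_def)
    also have "\<dots> = ((t - r) powr (\<alpha> - 1) * (t - r) powr (- \<alpha>)) * ((1 - u) powr (\<alpha> - 1) * u powr (- \<alpha>)) * ?c"
      using True r by (simp add: powr_mult)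
    also have "(t - r) powr (\<alpha> - 1) * (t - r) powr (- \<alpha>) = 1 / (t - r)"
      using r powr_add[of "t - r" "\<alpha> - 1" "- \<alpha>"] by (simp add: powr_minus_divide)
    finally show ?thesis using True r by simp
  next
    case False
    then consider "u \<le> 0" | "1 \<le> u" by linarith
    then have "?f (r + (t - r) * u) = 0"
    proof cases
      case 1
      then have "(t - r) * u \<le> 0" using r by (simp add: mult_nonneg_nonpos)
      then show ?thesis by (simp add: frac_kernel_def)
    next
      case 2
      then have "(t - r) * 1 \<le> (t - r) * u" using r by (intro mult_left_mono) auto
      then show ?thesis by (simp add: frac_kernel_def)
    qed
    moreover have "?g u = 0" using False by (cases "u = 0 \<or> u = 1") (auto simp: indicator_def)
    ultimately show ?thesis by (simp only: mult_zero_right)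
  qed
  have "set_integrable lborel {0..1} (\<lambda>u. u powr ((1 - \<alpha>) - 1) * (1 - u) powr (\<alpha> - 1))"
    using integrable_Beta[of "1 - \<alpha>" \<alpha>] \<alpha> by simp
  note int = this[unfolded set_integrable_def] set_borel_integral_eq_integral(2)[OF this]
  have "integral {0..1} (\<lambda>u. u powr ((1 - \<alpha>) - 1) * (1 - u) powr (\<alpha> - 1)) = Gamma (1 - \<alpha>) * Gamma \<alpha>"
    using has_integral_Beta_real[of "1 - \<alpha>" \<alpha>] \<alpha>
    by (auto simp: Beta_def intro!: integral_unique)
  with int(2) have "(\<integral>u. ?g u \<partial>lborel) = Gamma (1 - \<alpha>) * Gamma \<alpha>"
    by (simp add: set_lebesgue_integral_def)
  then have "(\<integral>u. ?c * ?g u \<partial>lborel) = 1" using G by simp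
  moreover have "integrable lborel (\<lambda>u. ?c * ?g u)" using int(1) by simp
  ultimately have 1: "integrable lborel (\<lambda>u. (t - r) * ?f (r + (t - r) * u))"
      "(\<integral>u. (t - r) * ?f (r + (t - r) * u) \<partial>lborel) = 1"
    unfolding eq by auto
  have "integrable lborel (\<lambda>u. ?f (r + (t - r) * u))" using 1(1) r by simp
  then have "integrable lborel ?f"
    using lborel_integrable_real_affine_iff[of "t - r" ?f r] r by simp
  moreover have "(\<integral>s. ?f s \<partial>lborel) = 1"
    using lborel_integral_real_affine[of "t - r" ?f r] 1(2) r by simp
  ultimately show ?thesis by (simp add: has_bochner_integral_iff)
qed

text \<open>
  Fubini's theorem reduces \<open>I\<^sup>\<alpha> I\<^sup>1\<^sup>-\<^sup>\<alpha>\<close> to the convolution of the two kernels, which is constantly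
  \<open>1\<close>.
\<close>
lemma RL_integral_semigroup:
  fixes p :: "real \<Rightarrow> real"
  assumes \<alpha>: "0 < \<alpha>" "\<alpha> < 1" and t: "0 \<le> t" and cont: "continuous_on {0..t} p"
  shows "RL_integral \<alpha> (RL_integral (1 - \<alpha>) p) t = integral {0..t} p"
proof -
  let ?F = "\<lambda>r s. frac_kernel \<alpha> t (t - s) * frac_kernel (1 - \<alpha>) t (s - r) * zero_ext t p r"
  note [measurable] = zero_ext_measurable[OF cont]
  have cont': "continuous_on {0..t} (RL_integral (1 - \<alpha>) p)"
    using \<alpha> t cont by (intro continuous_on_RL_integral) auto
  obtain B where B: "\<And>s. \<bar>zero_ext t p s\<bar> \<le> B" using zero_ext_bounded[OF cont] by metis
  have hb: "has_bochner_integral lborel (\<lambda>s. ?F r s) (zero_ext t p r)" if "r \<noteq> t" for r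
  proof (cases "r \<in> {0..t}")
    case True
    then show ?thesis
      using has_bochner_integral_mult_left[OF frac_kernel_convolution[OF \<alpha>, of r t]] that by simp
  qed (auto simp: zero_ext_def intro: has_bochner_integral_zero)
  have pint: "set_integrable lborel {0..t} p" 
    using cont by (rule borel_integrable_atLeastAtMost')
  have int: "integrable (lborel \<Otimes>\<^sub>M lborel) (\<lambda>(r, s). ?F r s)"
  proof (rule lborel_pair.Fubini_integrable)
    show "(\<lambda>(r, s). ?F r s) \<in> borel_measurable (lborel \<Otimes>\<^sub>M lborel)" by measurable
    have "integrable lborel (\<lambda>r. \<bar>zero_ext t p r\<bar>)"
      using pint unfolding set_integrable_def zero_ext_def by simp
    moreover have "(\<integral>s. norm (?F r s) \<partial>lborel) = \<bar>zero_ext t p r\<bar>" if "r \<noteq> t" for r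
    proof (cases "r \<in> {0..t}")
      case True
      have "norm (?F r s) = frac_kernel \<alpha> t (t - s) * frac_kernel (1 - \<alpha>) t (s - r) * \<bar>zero_ext t p r\<bar>" for s
        using \<alpha> by (simp add: abs_mult frac_kernel_nonneg)
      then show ?thesis
        using has_bochner_integral_integral_eq[OF frac_kernel_convolution[OF \<alpha>, of r t]] True that by simp
    qed (simp add: zero_ext_def)
    ultimately show "integrable lborel (\<lambda>r. \<integral>s. norm (case (r, s) of (r, s) \<Rightarrow> ?F r s) \<partial>lborel)"
      using AE_lborel_singleton[of t]
      by (subst integrable_cong_AE[where g="\<lambda>r. \<bar>zero_ext t p r\<bar>"]) (auto elim: eventually_mono)
    show "AE r in lborel. integrable lborel (\<lambda>s. case (r, s) of (r, s) \<Rightarrow> ?F r s)"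
      using AE_lborel_singleton[of t] hb by (auto elim!: eventually_mono simp: has_bochner_integral_iff)
  qed
  have conv: "(\<integral>r. frac_kernel (1 - \<alpha>) t (s - r) * zero_ext t p r \<partial>lborel)
      = (\<integral>r. frac_kernel (1 - \<alpha>) t r * zero_ext t p (s - r) \<partial>lborel)" for s
    using lborel_integral_real_affine[of "-1" "\<lambda>r. frac_kernel (1 - \<alpha>) t (s - r) * zero_ext t p r" s]
    by simp
  have "RL_integral \<alpha> (RL_integral (1 - \<alpha>) p) t
      = (\<integral>r. frac_kernel \<alpha> t r * zero_ext t (RL_integral (1 - \<alpha>) p) (t - r) \<partial>lborel)"
    using t by (intro RL_integral_convolution zero_ext_measurable cont') auto
  also have "\<dots> = (\<integral>s. frac_kernel \<alpha> t (t - s) * zero_ext t (RL_integral (1 - \<alpha>) p) s \<partial>lborel)"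
    using lborel_integral_real_affine[of "-1" "\<lambda>s. frac_kernel \<alpha> t (t - s) * zero_ext t (RL_integral (1 - \<alpha>) p) s" t]
    by simp
  also have "\<dots> = (\<integral>s. (\<integral>r. ?F r s \<partial>lborel) \<partial>lborel)"
  proof (intro Bochner_Integration.integral_cong refl)
    fix s
    show "frac_kernel \<alpha> t (t - s) * zero_ext t (RL_integral (1 - \<alpha>) p) s = (\<integral>r. ?F r s \<partial>lborel)"
    proof (cases "s \<in> {0..t}")
      case True
      then show ?thesis
        using RL_integral_convolution[OF zero_ext_measurable[OF cont], of s "1 - \<alpha>"] conv[of s]
        by (simp add: zero_ext_def[of t "RL_integral (1 - \<alpha>) p"] mult.assoc)
    qed (auto simp: frac_kernel_def)
  qed
  also have "\<dots> = (\<integral>r. (\<integral>s. ?F r s \<partial>lborel) \<partial>lborel)"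
    by (rule lborel_pair.Fubini_integral[OF int])
  also have "\<dots> = (\<integral>r. zero_ext t p r \<partial>lborel)"
  proof (rule integral_cong_AE)
    show "AE r in lborel. (\<integral>s. ?F r s \<partial>lborel) = zero_ext t p r"
      using AE_lborel_singleton[of t]
      by (rule eventually_mono) (rule has_bochner_integral_integral_eq[OF hb])
  qed measurable
  also have "\<dots> = integral {0..t} p"
    using set_borel_integral_eq_integral(2)[OF pint] by (simp add: set_lebesgue_integral_def zero_ext_def)
  finally show ?thesis .
qed

text \<open>
  The inversion of the Caputo derivative \<open>q = I\<^sup>1\<^sup>-\<^sup>\<alpha> p'\<close>: applying \<open>I\<^sup>\<alpha>\<close> gives
  \<open>I\<^sup>\<alpha> q = p - p(0)\<close>, and since \<open>q(0) = 0\<close> the left-hand side has derivative \<open>I\<^sup>\<alpha> q'\<close>.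
\<close>
lemma RL_integral_deriv_inverse:
  assumes \<alpha>: "0 < \<alpha>" "\<alpha> < 1" and t: "t \<in> {0<..<T}"
    and p: "\<And>s. s \<in> {0..T} \<Longrightarrow> (p has_real_derivative p' s) (at s within {0..T})" and cont_p': "continuous_on {0..T} p'"
    and q: "\<And>s. s \<in> {0..T} \<Longrightarrow> (q has_real_derivative q' s) (at s within {0..T})" and cont_q': "continuous_on {0..T} q'"
    and q_eq: "\<And>s. s \<in> {0..T} \<Longrightarrow> q s = RL_integral (1 - \<alpha>) p' s"
  shows "RL_integral \<alpha> q' t = p' t"
proof -
  have q0: "q 0 = 0" using q_eq[of 0] t by (simp add: RL_integral_0)
  have eq: "RL_integral \<alpha> q r = p r - p 0" if r: "r \<in> {0..T}" for r
  proof -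
    have sub: "{0..r} \<subseteq> {0..T}" using r by auto
    have "RL_integral \<alpha> q r = RL_integral \<alpha> (RL_integral (1 - \<alpha>) p') r"
      using r by (intro RL_integral_cong q_eq) auto
    also have "\<dots> = integral {0..r} p'"
      using \<alpha> r continuous_on_subset[OF cont_p' sub] by (intro RL_integral_semigroup) auto
    also have "\<dots> = p r - p 0"
    proof (rule integral_unique, rule fundamental_theorem_of_calculus)
      show "(p has_vector_derivative p' s) (at s within {0..r})" if "s \<in> {0..r}" for s
        using DERIV_subset[OF p sub, of s] that sub
        by (auto simp: has_real_derivative_iff_has_vector_derivative)
    qed (use r in auto)
    finally show ?thesis .
  qed
  have "(RL_integral \<alpha> q has_real_derivative RL_integral \<alpha> q' t) (at t)"
    by (rule RL_integral_has_derivative[OF \<alpha>(1) t q cont_q' q0])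
  moreover have "(RL_integral \<alpha> q has_real_derivative p' t) (at t)"
  proof (rule has_field_derivative_transform_within_open)
    show "((\<lambda>r. p r - p 0) has_real_derivative p' t) (at t)"
      using p[of t] t at_within_Icc_at[of 0 t T] by (auto intro!: derivative_eq_intros)
    show "open {0<..<T}" by simp
    show "p r - p 0 = RL_integral \<alpha> q r" if "r \<in> {0<..<T}" for r
      using eq[of r] that by simp
  qed (use t in auto)
  ultimately show ?thesis by (rule DERIV_unique)
qed

section \<open>Calculus of functions with values in \<open>L\<^sup>2\<close>\<close>

lemma L2_measurable: "u \<in> L2 \<Omega> \<Longrightarrow> u \<in> borel_measurable (lebesgue_on \<Omega>)"
  by (simp add: L2_def)

lemma L2_inner_integrable:
  assumes "u \<in> L2 \<Omega>" "v \<in> L2 \<Omega>"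
  shows "integrable (lebesgue_on \<Omega>) (\<lambda>x. u x \<bullet> v x)"
proof (rule Bochner_Integration.integrable_bound)
  note [measurable] = L2_measurable[OF assms(1)] L2_measurable[OF assms(2)]
  show "integrable (lebesgue_on \<Omega>) (\<lambda>x. (norm (u x))\<^sup>2 + (norm (v x))\<^sup>2)"
    using assms by (simp add: L2_def)
  show "(\<lambda>x. u x \<bullet> v x) \<in> borel_measurable (lebesgue_on \<Omega>)" by measurable
  show "AE x in lebesgue_on \<Omega>. norm (u x \<bullet> v x) \<le> norm ((norm (u x))\<^sup>2 + (norm (v x))\<^sup>2)"
  proof (rule AE_I2)
    fix x
    have "\<bar>u x \<bullet> v x\<bar> \<le> norm (u x) * norm (v x)" by (rule Cauchy_Schwarz_ineq2)
    also have "\<dots> \<le> (norm (u x))\<^sup>2 + (norm (v x))\<^sup>2"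
      using sum_squares_bound[of "norm (u x)" "norm (v x)"]
        mult_nonneg_nonneg[OF norm_ge_zero[of "u x"] norm_ge_zero[of "v x"]] by linarith
    finally show "norm (u x \<bullet> v x) \<le> norm ((norm (u x))\<^sup>2 + (norm (v x))\<^sup>2)" by simp
  qed
qed

lemma L2_lincomb:
  assumes "u \<in> L2 \<Omega>" "v \<in> L2 \<Omega>"
  shows "(\<lambda>x. a *\<^sub>R u x + b *\<^sub>R v x) \<in> L2 \<Omega>"
proof -
  note [measurable] = L2_measurable[OF assms(1)] L2_measurable[OF assms(2)]
  have "integrable (lebesgue_on \<Omega>) (\<lambda>x. a\<^sup>2 * (u x \<bullet> u x) + 2 * a * b * (u x \<bullet> v x) + b\<^sup>2 * (v x \<bullet> v x))"
    using assms by (intro Bochner_Integration.integrable_add integrable_mult_right L2_inner_integrable)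
  also have "(\<lambda>x. a\<^sup>2 * (u x \<bullet> u x) + 2 * a * b * (u x \<bullet> v x) + b\<^sup>2 * (v x \<bullet> v x))
      = (\<lambda>x. (norm (a *\<^sub>R u x + b *\<^sub>R v x))\<^sup>2)"
    unfolding power2_norm_eq_inner
    by (simp add: inner_add inner_commute power2_eq_square algebra_simps)
  finally show ?thesis by (simp add: L2_def)
qed

lemma L2_scaleR: "u \<in> L2 \<Omega> \<Longrightarrow> (\<lambda>x. a *\<^sub>R u x) \<in> L2 \<Omega>"
  using L2_lincomb[of u \<Omega> u a 0] by simp

lemma L2_diff: "u \<in> L2 \<Omega> \<Longrightarrow> v \<in> L2 \<Omega> \<Longrightarrow> (\<lambda>x. u x - v x) \<in> L2 \<Omega>"
  using L2_lincomb[of u \<Omega> v 1 "-1"] by simp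

lemma L2_inner_commute: "L2_inner \<Omega> u v = L2_inner \<Omega> v u"
  by (simp add: L2_inner_def inner_commute)

lemma L2_inner_lincomb_left:
  assumes "u \<in> L2 \<Omega>" "v \<in> L2 \<Omega>" "w \<in> L2 \<Omega>"
  shows "L2_inner \<Omega> (\<lambda>x. a *\<^sub>R u x + b *\<^sub>R v x) w = a * L2_inner \<Omega> u w + b * L2_inner \<Omega> v w"
  using L2_inner_integrable[OF assms(1,3)] L2_inner_integrable[OF assms(2,3)]
  by (simp add: L2_inner_def inner_add_left)

lemma L2_inner_lincomb_right:
  assumes "u \<in> L2 \<Omega>" "v \<in> L2 \<Omega>" "w \<in> L2 \<Omega>"
  shows "L2_inner \<Omega> w (\<lambda>x. a *\<^sub>R u x + b *\<^sub>R v x) = a * L2_inner \<Omega> w u + b * L2_inner \<Omega> w v"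
  using L2_inner_lincomb_left[OF assms] by (simp add: L2_inner_commute)

lemma L2_inner_diff_left:
  assumes "u \<in> L2 \<Omega>" "v \<in> L2 \<Omega>" "w \<in> L2 \<Omega>"
  shows "L2_inner \<Omega> (\<lambda>x. u x - v x) w = L2_inner \<Omega> u w - L2_inner \<Omega> v w"
  using L2_inner_lincomb_left[OF assms, of 1 "-1"] by simp

lemma L2_inner_diff_right:
  assumes "u \<in> L2 \<Omega>" "v \<in> L2 \<Omega>" "w \<in> L2 \<Omega>"
  shows "L2_inner \<Omega> w (\<lambda>x. u x - v x) = L2_inner \<Omega> w u - L2_inner \<Omega> w v"
  using L2_inner_diff_left[OF assms] by (simp add: L2_inner_commute)

lemma L2_inner_nonneg: "0 \<le> L2_inner \<Omega> u u"
  unfolding L2_inner_def by (intro Bochner_Integration.integral_nonneg) simp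

lemma L2_norm_nonneg: "0 \<le> L2_norm \<Omega> u"
  by (simp add: L2_norm_def L2_inner_nonneg)

lemma L2_norm_power2: "(L2_norm \<Omega> u)\<^sup>2 = L2_inner \<Omega> u u"
  by (simp add: L2_norm_def L2_inner_nonneg)

text \<open>
  The classical discriminant argument for the quadratic form \<open>\<parallel>a u + b v\<parallel>\<^sup>2 \<ge> 0\<close>.
\<close>
lemma L2_Cauchy_Schwarz:
  assumes u: "u \<in> L2 \<Omega>" and v: "v \<in> L2 \<Omega>"
  shows "\<bar>L2_inner \<Omega> u v\<bar> \<le> L2_norm \<Omega> u * L2_norm \<Omega> v"
proof -
  let ?A = "L2_inner \<Omega> u u" and ?B = "L2_inner \<Omega> u v" and ?C = "L2_inner \<Omega> v v"
  have quad: "0 \<le> a\<^sup>2 * ?A + 2 * a * b * ?B + b\<^sup>2 * ?C" for a b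
  proof -
    let ?w = "\<lambda>x. a *\<^sub>R u x + b *\<^sub>R v x"
    have "L2_inner \<Omega> ?w ?w = a * (a * ?A + b * ?B) + b * (a * L2_inner \<Omega> v u + b * ?C)"
      using u v L2_lincomb[OF u v]
      by (simp add: L2_inner_lincomb_left L2_inner_lincomb_right)
    then show ?thesis
      using L2_inner_nonneg[of \<Omega> ?w]
      by (simp add: L2_inner_commute[of \<Omega> v u] power2_eq_square algebra_simps)
  qed
  have "?B\<^sup>2 \<le> ?A * ?C"
  proof (cases "?C = 0")
    case True
    \<comment> \<open>With \<open>?C = 0\<close> the form is affine in \<open>b\<close>, and this choice of \<open>b\<close> would make it equal to \<open>-1\<close>.\<close>
    have "?B = 0"
    proof (rule ccontr)
      assume "?B \<noteq> 0"
      then show False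
        using quad[of 1 "- (?A + 1) / (2 * ?B)"] L2_inner_nonneg[of \<Omega> u] True by (simp add: field_simps)
    qed
    then show ?thesis using True by simp
  next
    case False
    then have C: "?C > 0" using L2_inner_nonneg[of \<Omega> v] by simp
    have "0 \<le> ?C * (?A * ?C - ?B\<^sup>2)"
      using quad[of ?C "- ?B"] by (simp add: power2_eq_square algebra_simps)
    then show ?thesis using C by (simp add: zero_le_mult_iff)
  qed
  then have "sqrt (?B\<^sup>2) \<le> sqrt (?A * ?C)" by (rule real_sqrt_le_mono)
  then show ?thesis by (simp add: L2_norm_def real_sqrt_mult)
qed

lemma L2_norm_lincomb_le:
  assumes u: "u \<in> L2 \<Omega>" and v: "v \<in> L2 \<Omega>"
  shows "L2_norm \<Omega> (\<lambda>x. a *\<^sub>R u x + b *\<^sub>R v x) \<le> \<bar>a\<bar> * L2_norm \<Omega> u + \<bar>b\<bar> * L2_norm \<Omega> v"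
proof (rule power2_le_imp_le)
  let ?w = "\<lambda>x. a *\<^sub>R u x + b *\<^sub>R v x"
  have "(L2_norm \<Omega> ?w)\<^sup>2
      = a * (a * L2_inner \<Omega> u u + b * L2_inner \<Omega> u v) + b * (a * L2_inner \<Omega> v u + b * L2_inner \<Omega> v v)"
    using u v L2_lincomb[OF u v]
    by (simp add: L2_norm_power2 L2_inner_lincomb_left L2_inner_lincomb_right)
  also have "\<dots> = a\<^sup>2 * (L2_norm \<Omega> u)\<^sup>2 + 2 * (a * b * L2_inner \<Omega> u v) + b\<^sup>2 * (L2_norm \<Omega> v)\<^sup>2"
    unfolding L2_norm_power2
    by (simp add: L2_inner_commute[of \<Omega> v u] power2_eq_square algebra_simps)
  also have "a * b * L2_inner \<Omega> u v \<le> \<bar>a * b\<bar> * (L2_norm \<Omega> u * L2_norm \<Omega> v)"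
    using mult_left_mono[OF L2_Cauchy_Schwarz[OF u v] abs_ge_zero[of "a * b"]]
      abs_ge_self[of "a * b * L2_inner \<Omega> u v"]
    unfolding abs_mult[of "a * b" "L2_inner \<Omega> u v"] by linarith
  finally show "(L2_norm \<Omega> ?w)\<^sup>2 \<le> (\<bar>a\<bar> * L2_norm \<Omega> u + \<bar>b\<bar> * L2_norm \<Omega> v)\<^sup>2"
    by (simp add: power2_sum power_mult_distrib abs_mult algebra_simps)
qed (simp add: L2_norm_nonneg)

lemma tendsto_L2_inner:
  assumes f: "eventually (\<lambda>s. f s \<in> L2 \<Omega>) F" and g: "eventually (\<lambda>s. g s \<in> L2 \<Omega>) F"
    and u: "u \<in> L2 \<Omega>" and v: "v \<in> L2 \<Omega>"
    and fu: "((\<lambda>s. L2_norm \<Omega> (\<lambda>x. f s x - u x)) \<longlongrightarrow> 0) F"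
    and gv: "((\<lambda>s. L2_norm \<Omega> (\<lambda>x. g s x - v x)) \<longlongrightarrow> 0) F"
  shows "((\<lambda>s. L2_inner \<Omega> (f s) (g s)) \<longlongrightarrow> L2_inner \<Omega> u v) F"
proof -
  let ?a = "\<lambda>s. L2_norm \<Omega> (\<lambda>x. f s x - u x)" and ?b = "\<lambda>s. L2_norm \<Omega> (\<lambda>x. g s x - v x)"
  have "((\<lambda>s. ?a s * ?b s + ?a s * L2_norm \<Omega> v + L2_norm \<Omega> u * ?b s)
      \<longlongrightarrow> 0 * 0 + 0 * L2_norm \<Omega> v + L2_norm \<Omega> u * 0) F"
    by (intro tendsto_intros fu gv)
  then have lim: "((\<lambda>s. ?a s * ?b s + ?a s * L2_norm \<Omega> v + L2_norm \<Omega> u * ?b s) \<longlongrightarrow> 0) F"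
    by simp
  have "((\<lambda>s. L2_inner \<Omega> (f s) (g s) - L2_inner \<Omega> u v) \<longlongrightarrow> 0) F"
  proof (rule Lim_null_comparison[OF _ lim])
    show "eventually (\<lambda>s. norm (L2_inner \<Omega> (f s) (g s) - L2_inner \<Omega> u v)
        \<le> ?a s * ?b s + ?a s * L2_norm \<Omega> v + L2_norm \<Omega> u * ?b s) F"
      using f g
    proof eventually_elim
      case (elim s)
      let ?d = "\<lambda>x. f s x - u x" and ?e = "\<lambda>x. g s x - v x"
      have d: "?d \<in> L2 \<Omega>" and e: "?e \<in> L2 \<Omega>" using elim u v by (auto intro: L2_diff)
      have "L2_inner \<Omega> (f s) (g s) - L2_inner \<Omega> u v
          = L2_inner \<Omega> ?d ?e + L2_inner \<Omega> ?d v + L2_inner \<Omega> u ?e"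
        using elim u v d e by (simp add: L2_inner_diff_left L2_inner_diff_right)
      moreover have "\<bar>L2_inner \<Omega> ?d ?e\<bar> \<le> ?a s * ?b s" "\<bar>L2_inner \<Omega> ?d v\<bar> \<le> ?a s * L2_norm \<Omega> v"
          "\<bar>L2_inner \<Omega> u ?e\<bar> \<le> L2_norm \<Omega> u * ?b s"
        using d e u v by (auto intro: L2_Cauchy_Schwarz)
      ultimately show ?case by simp
    qed
  qed
  then show ?thesis by (simp add: LIM_zero_iff)
qed

lemma eventually_at_withinI: "(\<And>s. s \<in> S \<Longrightarrow> P s) \<Longrightarrow> eventually P (at t within S)"
  by (simp add: eventually_at_filter)

lemma continuous_on_L2_inner:
  assumes u: "C0_into (L2 \<Omega>) (L2_norm \<Omega>) T u" and v: "C0_into (L2 \<Omega>) (L2_norm \<Omega>) T v"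
  shows "continuous_on {0..T} (\<lambda>t. L2_inner \<Omega> (u t) (v t))"
  unfolding continuous_on_def
proof
  fix t assume t: "t \<in> {0..T}"
  have "eventually (\<lambda>s. u s \<in> L2 \<Omega>) (at t within {0..T})" "eventually (\<lambda>s. v s \<in> L2 \<Omega>) (at t within {0..T})"
    by (rule eventually_at_withinI, use u v in \<open>simp add: C0_into_def\<close>)+
  then show "((\<lambda>t. L2_inner \<Omega> (u t) (v t)) \<longlongrightarrow> L2_inner \<Omega> (u t) (v t)) (at t within {0..T})"
    using u v t by (intro tendsto_L2_inner) (auto simp: C0_into_def)
qed

lemma C0_into_const: "v \<in> L2 \<Omega> \<Longrightarrow> C0_into (L2 \<Omega>) (L2_norm \<Omega>) T (\<lambda>_. v)"
  by (simp add: C0_into_def L2_norm_def L2_inner_def)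

lemma C1_into_const:
  fixes v :: "'a::euclidean_space \<Rightarrow> 'b::euclidean_space"
  assumes v: "v \<in> L2 \<Omega>"
  shows "C1_into (L2 \<Omega>) (L2_norm \<Omega>) T (\<lambda>_. v) (\<lambda>_ _. 0)"
proof -
  have "(\<lambda>_. 0 :: 'b) \<in> L2 \<Omega>" using L2_scaleR[OF v, of 0] by simp
  moreover have "L2_norm \<Omega> (\<lambda>_. 0 :: 'b) = 0" by (simp add: L2_norm_def L2_inner_def)
  ultimately show ?thesis using v by (simp add: C1_into_def C0_into_const)
qed

lemma tendsto_L2_norm_lincomb:
  assumes f: "eventually (\<lambda>s. f s \<in> L2 \<Omega>) F" and g: "eventually (\<lambda>s. g s \<in> L2 \<Omega>) F"
    and "((\<lambda>s. L2_norm \<Omega> (f s)) \<longlongrightarrow> 0) F" and "((\<lambda>s. L2_norm \<Omega> (g s)) \<longlongrightarrow> 0) F"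
  shows "((\<lambda>s. L2_norm \<Omega> (\<lambda>x. a *\<^sub>R f s x + b *\<^sub>R g s x)) \<longlongrightarrow> 0) F"
proof (rule Lim_null_comparison)
  have "((\<lambda>s. \<bar>a\<bar> * L2_norm \<Omega> (f s) + \<bar>b\<bar> * L2_norm \<Omega> (g s)) \<longlongrightarrow> \<bar>a\<bar> * 0 + \<bar>b\<bar> * 0) F"
    by (intro tendsto_intros assms)
  then show "((\<lambda>s. \<bar>a\<bar> * L2_norm \<Omega> (f s) + \<bar>b\<bar> * L2_norm \<Omega> (g s)) \<longlongrightarrow> 0) F" by simp
  show "eventually (\<lambda>s. norm (L2_norm \<Omega> (\<lambda>x. a *\<^sub>R f s x + b *\<^sub>R g s x))
      \<le> \<bar>a\<bar> * L2_norm \<Omega> (f s) + \<bar>b\<bar> * L2_norm \<Omega> (g s)) F"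
    using f g by eventually_elim (simp add: L2_norm_nonneg L2_norm_lincomb_le)
qed

lemma C0_into_lincomb:
  assumes u: "C0_into (L2 \<Omega>) (L2_norm \<Omega>) T u" and v: "C0_into (L2 \<Omega>) (L2_norm \<Omega>) T v"
  shows "C0_into (L2 \<Omega>) (L2_norm \<Omega>) T (\<lambda>t x. a *\<^sub>R u t x + b *\<^sub>R v t x)"
  unfolding C0_into_def
proof (intro ballI conjI)
  have mem: "u s \<in> L2 \<Omega>" "v s \<in> L2 \<Omega>" if "s \<in> {0..T}" for s
    using that u v unfolding C0_into_def by blast+
  fix t assume t: "t \<in> {0..T}"
  show "(\<lambda>x. a *\<^sub>R u t x + b *\<^sub>R v t x) \<in> L2 \<Omega>"
    by (rule L2_lincomb[OF mem[OF t]])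
  have "((\<lambda>s. L2_norm \<Omega> (\<lambda>x. a *\<^sub>R (u s x - u t x) + b *\<^sub>R (v s x - v t x))) \<longlongrightarrow> 0) (at t within {0..T})"
  proof (rule tendsto_L2_norm_lincomb)
    show "eventually (\<lambda>s. (\<lambda>x. u s x - u t x) \<in> L2 \<Omega>) (at t within {0..T})"
      by (rule eventually_at_withinI) (rule L2_diff[OF mem(1) mem(1)[OF t]])
    show "eventually (\<lambda>s. (\<lambda>x. v s x - v t x) \<in> L2 \<Omega>) (at t within {0..T})"
      by (rule eventually_at_withinI) (rule L2_diff[OF mem(2) mem(2)[OF t]])
    show "((\<lambda>s. L2_norm \<Omega> (\<lambda>x. u s x - u t x)) \<longlongrightarrow> 0) (at t within {0..T})"
      "((\<lambda>s. L2_norm \<Omega> (\<lambda>x. v s x - v t x)) \<longlongrightarrow> 0) (at t within {0..T})"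
      using u v t unfolding C0_into_def by blast+
  qed
  moreover have "(\<lambda>x. a *\<^sub>R (u s x - u t x) + b *\<^sub>R (v s x - v t x))
      = (\<lambda>x. a *\<^sub>R u s x + b *\<^sub>R v s x - (a *\<^sub>R u t x + b *\<^sub>R v t x))" for s
    by (rule ext) (simp add: scaleR_diff_right)
  ultimately show "((\<lambda>s. L2_norm \<Omega> (\<lambda>x. a *\<^sub>R u s x + b *\<^sub>R v s x - (a *\<^sub>R u t x + b *\<^sub>R v t x))) \<longlongrightarrow> 0) (at t within {0..T})"
    by simp
qed

lemma C1_into_lincomb:
  assumes u: "C1_into (L2 \<Omega>) (L2_norm \<Omega>) T u u'" and v: "C1_into (L2 \<Omega>) (L2_norm \<Omega>) T v v'"
  shows "C1_into (L2 \<Omega>) (L2_norm \<Omega>) T (\<lambda>t x. a *\<^sub>R u t x + b *\<^sub>R v t x) (\<lambda>t x. a *\<^sub>R u' t x + b *\<^sub>R v' t x)"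
  unfolding C1_into_def
proof (intro ballI conjI)
  show "C0_into (L2 \<Omega>) (L2_norm \<Omega>) T (\<lambda>t x. a *\<^sub>R u t x + b *\<^sub>R v t x)"
    "C0_into (L2 \<Omega>) (L2_norm \<Omega>) T (\<lambda>t x. a *\<^sub>R u' t x + b *\<^sub>R v' t x)"
    using u v by (auto simp: C1_into_def intro: C0_into_lincomb)
  have mem: "u t \<in> L2 \<Omega>" "u' t \<in> L2 \<Omega>" "v t \<in> L2 \<Omega>" "v' t \<in> L2 \<Omega>" if "t \<in> {0..T}" for t
    using that u v unfolding C1_into_def C0_into_def by blast+
  fix t assume t: "t \<in> {0..T}"
  have "((\<lambda>s. L2_norm \<Omega> (\<lambda>x. a *\<^sub>R ((u s x - u t x) /\<^sub>R (s - t) - u' t x)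
      + b *\<^sub>R ((v s x - v t x) /\<^sub>R (s - t) - v' t x))) \<longlongrightarrow> 0) (at t within {0..T})"
  proof (rule tendsto_L2_norm_lincomb)
    show "eventually (\<lambda>s. (\<lambda>x. (u s x - u t x) /\<^sub>R (s - t) - u' t x) \<in> L2 \<Omega>) (at t within {0..T})"
      "eventually (\<lambda>s. (\<lambda>x. (v s x - v t x) /\<^sub>R (s - t) - v' t x) \<in> L2 \<Omega>) (at t within {0..T})"
      using t by (auto intro!: eventually_at_withinI L2_diff L2_scaleR mem)
  qed (use u v t in \<open>auto simp: C1_into_def\<close>)
  moreover have "(\<lambda>x. a *\<^sub>R ((u s x - u t x) /\<^sub>R (s - t) - u' t x)
        + b *\<^sub>R ((v s x - v t x) /\<^sub>R (s - t) - v' t x))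
      = (\<lambda>x. (a *\<^sub>R u s x + b *\<^sub>R v s x - (a *\<^sub>R u t x + b *\<^sub>R v t x)) /\<^sub>R (s - t)
        - (a *\<^sub>R u' t x + b *\<^sub>R v' t x))" for s
    by (rule ext) (simp add: scaleR_diff_right scaleR_add_right mult.commute)
  ultimately show "((\<lambda>s. L2_norm \<Omega> (\<lambda>x. (a *\<^sub>R u s x + b *\<^sub>R v s x - (a *\<^sub>R u t x + b *\<^sub>R v t x)) /\<^sub>R (s - t)
      - (a *\<^sub>R u' t x + b *\<^sub>R v' t x))) \<longlongrightarrow> 0) (at t within {0..T})"
    by simp
qed

text \<open>
  The product rule. The difference quotient of \<open>(u, v)\<close> at \<open>t\<close> splits into
  \<open>(D u, v s) + (u t, D v)\<close>, where \<open>D\<close> denotes the difference quotients of the factors, and the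
  inner product is jointly continuous.
\<close>
lemma has_derivative_L2_inner:
  assumes u: "C1_into (L2 \<Omega>) (L2_norm \<Omega>) T u u'" and v: "C1_into (L2 \<Omega>) (L2_norm \<Omega>) T v v'"
    and t: "t \<in> {0..T}"
  shows "((\<lambda>s. L2_inner \<Omega> (u s) (v s)) has_real_derivative
    L2_inner \<Omega> (u' t) (v t) + L2_inner \<Omega> (u t) (v' t)) (at t within {0..T})"
proof -
  have mem: "u t \<in> L2 \<Omega>" "u' t \<in> L2 \<Omega>" "v t \<in> L2 \<Omega>" "v' t \<in> L2 \<Omega>" if "t \<in> {0..T}" for t
    using that u v unfolding C1_into_def C0_into_def by blast+
  let ?Du = "\<lambda>s x. (u s x - u t x) /\<^sub>R (s - t)" and ?Dv = "\<lambda>s x. (v s x - v t x) /\<^sub>R (s - t)"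
  have evs: "eventually (\<lambda>s. ?Du s \<in> L2 \<Omega>) (at t within {0..T})"
      "eventually (\<lambda>s. ?Dv s \<in> L2 \<Omega>) (at t within {0..T})"
    using t by (auto intro!: eventually_at_withinI L2_diff L2_scaleR mem)
  have evv: "eventually (\<lambda>s. v s \<in> L2 \<Omega>) (at t within {0..T})"
    by (rule eventually_at_withinI) (rule mem)
  have "((\<lambda>s. L2_inner \<Omega> (?Du s) (v s)) \<longlongrightarrow> L2_inner \<Omega> (u' t) (v t)) (at t within {0..T})"
    using u v t evs evv mem by (intro tendsto_L2_inner) (auto simp: C1_into_def C0_into_def)
  moreover have "((\<lambda>s. L2_inner \<Omega> (u t) (?Dv s)) \<longlongrightarrow> L2_inner \<Omega> (u t) (v' t)) (at t within {0..T})"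
    using u v t evs mem C0_into_const[OF mem(1)[OF t], of T]
    by (intro tendsto_L2_inner) (auto simp: C1_into_def C0_into_def)
  ultimately have "((\<lambda>s. L2_inner \<Omega> (?Du s) (v s) + L2_inner \<Omega> (u t) (?Dv s)) \<longlongrightarrow>
      L2_inner \<Omega> (u' t) (v t) + L2_inner \<Omega> (u t) (v' t)) (at t within {0..T})"
    by (rule tendsto_add)
  moreover have "eventually (\<lambda>s. L2_inner \<Omega> (?Du s) (v s) + L2_inner \<Omega> (u t) (?Dv s)
      = (L2_inner \<Omega> (u s) (v s) - L2_inner \<Omega> (u t) (v t)) / (s - t)) (at t within {0..T})"
  proof (rule eventually_at_withinI)
    fix s assume elim: "s \<in> {0..T}"
    have "?Du s = (\<lambda>x. (1 / (s - t)) *\<^sub>R u s x + (- (1 / (s - t))) *\<^sub>R u t x)"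
      "?Dv s = (\<lambda>x. (1 / (s - t)) *\<^sub>R v s x + (- (1 / (s - t))) *\<^sub>R v t x)"
      by (auto simp: inverse_eq_divide scaleR_diff_right)
    then show "L2_inner \<Omega> (?Du s) (v s) + L2_inner \<Omega> (u t) (?Dv s)
      = (L2_inner \<Omega> (u s) (v s) - L2_inner \<Omega> (u t) (v t)) / (s - t)"
      using mem[OF t] mem[OF elim]
      by (simp only: L2_inner_lincomb_left L2_inner_lincomb_right) (simp add: diff_divide_distrib)
  qed
  ultimately show ?thesis
    unfolding has_field_derivative_iff by (rule Lim_transform_eventually)
qed

text \<open>
  A fractional substitute for \<open>(\<parallel>w\<parallel>\<^sup>2)' = 2 (w', w)\<close>. The difference of the two fractional integrals
  is \<open>I\<^sup>\<alpha> m' (t)\<close> for the nonnegative function \<open>m s = \<parallel>w t - w s\<parallel>\<^sup>2\<close>, which vanishes at \<open>s = t\<close>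
  and equals \<open>\<parallel>w t\<parallel>\<^sup>2\<close> at \<open>s = 0\<close>. Requiring \<open>w 0 = 0\<close> only weakly accommodates functions that are
  determined up to null sets.
\<close>
lemma L2_fractional_chain_inequality:
  assumes \<alpha>: "0 < \<alpha>" "\<alpha> \<le> 1" and t: "t \<in> {0<..T}"
    and w: "C1_into (L2 \<Omega>) (L2_norm \<Omega>) T w w'"
    and w0: "\<And>\<psi>. \<psi> \<in> L2 \<Omega> \<Longrightarrow> L2_inner \<Omega> (w 0) \<psi> = 0"
  shows "RL_integral \<alpha> (\<lambda>s. L2_inner \<Omega> (w' s) (w s) + L2_inner \<Omega> (w s) (w' s)) t
    \<le> 2 * RL_integral \<alpha> (\<lambda>s. L2_inner \<Omega> (w' s) (w t)) t - eta \<alpha> t * L2_inner \<Omega> (w t) (w t)"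
proof -
  have sub: "{0..t} \<subseteq> {0..T}" using t by auto
  have mem: "w s \<in> L2 \<Omega>" "w' s \<in> L2 \<Omega>" if "s \<in> {0..T}" for s
    using that w unfolding C1_into_def C0_into_def by blast+
  have wt: "w t \<in> L2 \<Omega>" and w0mem: "w 0 \<in> L2 \<Omega>" using t by (auto intro: mem)
  let ?q' = "\<lambda>s. L2_inner \<Omega> (w' s) (w t)"
  let ?N' = "\<lambda>s. L2_inner \<Omega> (w' s) (w s) + L2_inner \<Omega> (w s) (w' s)"
  define m where "m s = L2_inner \<Omega> (w t) (w t) + (- 2) * L2_inner \<Omega> (w s) (w t) + 1 * L2_inner \<Omega> (w s) (w s)" for s
  have C0: "C0_into (L2 \<Omega>) (L2_norm \<Omega>) T w" "C0_into (L2 \<Omega>) (L2_norm \<Omega>) T w'"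
    using w by (auto simp: C1_into_def)
  have cont: "continuous_on {0..t} ?q'" "continuous_on {0..t} ?N'"
    using C0 wt
    by (auto intro!: continuous_on_subset[OF _ sub] continuous_on_add continuous_on_L2_inner C0_into_const)
  have der: "(m has_real_derivative (- 2) * ?q' s + 1 * ?N' s) (at s within {0..t})" if "s \<in> {0..t}" for s
  proof -
    have s: "s \<in> {0..T}" using that sub by blast
    have "L2_inner \<Omega> (w s) (\<lambda>_. 0) = 0" by (simp add: L2_inner_def)
    then have "((\<lambda>s. L2_inner \<Omega> (w s) (w t)) has_real_derivative ?q' s) (at s within {0..t})"
      using has_derivative_L2_inner[OF w C1_into_const[OF wt] s] by (auto intro: DERIV_subset[OF _ sub])
    moreover have "((\<lambda>s. L2_inner \<Omega> (w s) (w s)) has_real_derivative ?N' s) (at s within {0..t})"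
      using has_derivative_L2_inner[OF w w s] by (rule DERIV_subset[OF _ sub])
    ultimately show ?thesis
      unfolding m_def[abs_def] by (auto intro!: derivative_eq_intros)
  qed
  have m_norm: "m s = L2_inner \<Omega> (\<lambda>x. w t x - w s x) (\<lambda>x. w t x - w s x)" if "s \<in> {0..T}" for s
    using wt mem(1)[OF that] L2_diff[OF wt mem(1)[OF that]]
    by (simp add: m_def L2_inner_diff_left L2_inner_diff_right L2_inner_commute[of \<Omega> "w t" "w s"])
  have "RL_integral \<alpha> (\<lambda>s. (- 2) * ?q' s + 1 * ?N' s) t \<le> - eta \<alpha> t * m 0"
  proof (rule RL_integral_deriv_le[OF \<alpha> _ der])
    show "0 < t" using t by simp
    show "continuous_on {0..t} (\<lambda>s. (- 2) * ?q' s + 1 * ?N' s)"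
      by (intro continuous_intros cont)
    show "0 \<le> m s" if "s \<in> {0..t}" for s
      using m_norm[of s] that sub L2_inner_nonneg by auto
    show "m t = 0" by (simp add: m_def)
  qed
  moreover have "RL_integral \<alpha> (\<lambda>s. (- 2) * ?q' s + 1 * ?N' s) t
      = (- 2) * RL_integral \<alpha> ?q' t + 1 * RL_integral \<alpha> ?N' t"
    using t \<alpha> cont by (intro RL_integral_lincomb) auto
  moreover have "m 0 = L2_inner \<Omega> (w t) (w t)"
    using w0[OF wt] w0[OF w0mem] by (simp add: m_def)
  ultimately show ?thesis by simp
qed

section \<open>Testing a fractional time integral in space\<close>

lemma lebesgue_ex_borel:
  fixes f :: "'a::euclidean_space \<Rightarrow> 'b::euclidean_space"
  assumes "f \<in> borel_measurable lebesgue"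
  obtains g where "g \<in> borel_measurable borel" "AE x in lborel. f x = g x"
proof -
  have "\<exists>g\<in>borel_measurable lborel. AE x in lborel. f x \<bullet> b = g x" for b
    using borel_measurable_inner[OF assms, of "\<lambda>_. b"] by (intro completion_ex_borel_measurable_real) simp
  then obtain g where "\<forall>b. g b \<in> borel_measurable lborel \<and> (AE x in lborel. f x \<bullet> b = g b x)"
    by metis
  then have g: "\<And>b. g b \<in> borel_measurable borel" and ae: "\<And>b. AE x in lborel. f x \<bullet> b = g b x"
    by auto
  note [measurable] = g
  show ?thesis
  proof
    show "(\<lambda>x. \<Sum>b\<in>Basis. g b x *\<^sub>R b) \<in> borel_measurable borel" by measurable
    have "AE x in lborel. \<forall>b\<in>Basis. f x \<bullet> b = g b x"
      using ae by (intro AE_finite_allI) auto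
    then show "AE x in lborel. f x = (\<Sum>b\<in>Basis. g b x *\<^sub>R b)"
      by eventually_elim (subst euclidean_representation[symmetric], auto intro!: sum.cong)
  qed
qed

text \<open>
  Product measures and Fubini's theorem are available for Borel functions, whereas the fields are
  only Lebesgue measurable. This lemma and the following one carry results about a Borel
  representative back. That \<open>v\<close> is measurable is a conclusion, by completeness of the Lebesgue
  measure, so that the lemma applies to fields that are themselves defined by an integral.
\<close>
lemma lebesgue_integral_borel_representative:
  fixes u v :: "'a::euclidean_space \<Rightarrow> 'b::euclidean_space"
  assumes u: "u \<in> borel_measurable borel" and ae: "AE x in lborel. v x = u x"
  shows "v \<in> borel_measurable lebesgue"
    and "integrable lebesgue v \<longleftrightarrow> integrable lborel u"
    and "(\<integral>x. v x \<partial>lebesgue) = (\<integral>x. u x \<partial>lborel)"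
proof -
  have aec: "AE x in lebesgue. v x = u x" using ae by (rule AE_completion)
  have [measurable]: "u \<in> borel_measurable lborel" using u by simp
  then have [measurable]: "u \<in> borel_measurable lebesgue" by (rule measurable_completion)
  show [measurable]: "v \<in> borel_measurable lebesgue"
  proof (rule measurableI)
    fix A :: "'b set" assume A: "A \<in> sets borel"
    have "u -` A \<in> sets lebesgue"
      using measurable_sets[OF \<open>u \<in> borel_measurable lebesgue\<close> A] by simp
    moreover have "AE x in lebesgue. x \<in> u -` A \<longleftrightarrow> x \<in> v -` A"
      using aec by eventually_elim auto
    ultimately show "v -` A \<inter> space lebesgue \<in> sets lebesgue"
      using completion.in_sets_AE[where A="u -` A" and B="v -` A"] by simp
  qed simp
  have "integrable lebesgue v \<longleftrightarrow> integrable lebesgue u"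
    using aec by (intro integrable_cong_AE) auto
  then show "integrable lebesgue v \<longleftrightarrow> integrable lborel u" by (simp add: integrable_completion)
  have "(\<integral>x. v x \<partial>lebesgue) = (\<integral>x. u x \<partial>lebesgue)"
    using aec by (intro integral_cong_AE) auto
  then show "(\<integral>x. v x \<partial>lebesgue) = (\<integral>x. u x \<partial>lborel)" by (simp add: integral_completion)
qed

lemma lebesgue_on_integral_borel_representative:
  fixes u v :: "'a::euclidean_space \<Rightarrow> 'b::euclidean_space"
  assumes \<Omega>: "\<Omega> \<in> sets lebesgue" and u: "u \<in> borel_measurable borel"
    and ae: "AE x in lborel. (if x \<in> \<Omega> then v x else 0) = u x"
  shows "integrable (lebesgue_on \<Omega>) v \<longleftrightarrow> integrable lborel u"
    and "(\<integral>x. v x \<partial>lebesgue_on \<Omega>) = (\<integral>x. u x \<partial>lborel)"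
proof -
  have eq: "(\<lambda>x. indicator \<Omega> x *\<^sub>R v x) = (\<lambda>x. if x \<in> \<Omega> then v x else 0)" by auto
  show "integrable (lebesgue_on \<Omega>) v \<longleftrightarrow> integrable lborel u"
    using \<Omega> lebesgue_integral_borel_representative(2)[OF u ae] by (simp add: integrable_restrict_space eq)
  show "(\<integral>x. v x \<partial>lebesgue_on \<Omega>) = (\<integral>x. u x \<partial>lborel)"
    using \<Omega> lebesgue_integral_borel_representative(3)[OF u ae] by (simp add: integral_restrict_space eq)
qed

text \<open>
  The exceptional set of \<open>Q\<close>, possibly not a Borel set, is first enclosed in a Borel null set, to
  which the theorems on product measures apply.
\<close>
lemma AE_lborel_pair:
  fixes Q :: "'a::euclidean_space \<Rightarrow> 'b::euclidean_space \<Rightarrow> bool"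
  assumes "AE z in lborel. Q (fst z) (snd z)"
  shows "AE s in lborel. AE x in lborel. Q s x" and "AE x in lborel. AE s in lborel. Q s x"
proof -
  obtain N :: "('a \<times> 'b) set" where N: "N \<in> null_sets lborel" and sub': "\<And>z. \<not> Q (fst z) (snd z) \<Longrightarrow> z \<in> N"
    using assms unfolding eventually_ae_filter by auto
  have sub: "Q s x" if "(s, x) \<notin> N" for s x
    using sub'[of "(s, x)"] that by auto
  have N': "N \<in> null_sets (lborel \<Otimes>\<^sub>M lborel)" using N by (simp only: lborel_prod)
  then have [measurable]: "N \<in> sets (lborel \<Otimes>\<^sub>M lborel)" by (rule null_setsD2)
  have "AE z in lborel \<Otimes>\<^sub>M lborel. z \<notin> N" using N' by (rule AE_not_in)
  then have 1: "AE s in lborel. AE x in lborel. (s, x) \<notin> N"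
    by (rule lborel_pair.AE_pair)
  have "{z \<in> space (lborel \<Otimes>\<^sub>M lborel). (fst z, snd z) \<notin> N} \<in> sets (lborel \<Otimes>\<^sub>M lborel)"
    by measurable
  from lborel_pair.AE_commute[OF this] 1 have 2: "AE x in lborel. AE s in lborel. (s, x) \<notin> N"
    by simp
  show "AE s in lborel. AE x in lborel. Q s x"
    using 1 by eventually_elim (auto elim!: eventually_mono dest: sub)
  show "AE x in lborel. AE s in lborel. Q s x"
    using 2 by eventually_elim (auto elim!: eventually_mono dest: sub)
qed

lemma integrable_weighted_slices:
  fixes h :: "real \<Rightarrow> 'a::euclidean_space \<Rightarrow> 'b::euclidean_space"
  assumes K: "integrable lborel K"
    and h: "(\<lambda>(s, x). h s x) \<in> borel_measurable (lborel \<Otimes>\<^sub>M lborel)"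
    and int: "AE s in lborel. integrable lborel (h s)"
    and bound: "AE s in lborel. (\<integral>x. norm (h s x) \<partial>lborel) \<le> C"
  shows "integrable (lborel \<Otimes>\<^sub>M lborel) (\<lambda>(s, x). K s *\<^sub>R h s x)"
proof (rule lborel_pair.Fubini_integrable)
  have [measurable]: "(K :: real \<Rightarrow> real) \<in> borel_measurable lborel"
    using K by (rule borel_measurable_integrable)
  note [measurable] = h
  show "(\<lambda>(s, x). K s *\<^sub>R h s x) \<in> borel_measurable (lborel \<Otimes>\<^sub>M lborel)" by measurable
  show "AE s in lborel. integrable lborel (\<lambda>x. case (s, x) of (s, x) \<Rightarrow> K s *\<^sub>R h s x)"
    using int by eventually_elim auto
  have "integrable lborel (\<lambda>s. \<bar>K s\<bar> * (\<integral>x. norm (h s x) \<partial>lborel))"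
  proof (rule Bochner_Integration.integrable_bound)
    show "integrable lborel (\<lambda>s. K s * C)" using K by simp
    show "AE s in lborel. norm (\<bar>K s\<bar> * (\<integral>x. norm (h s x) \<partial>lborel)) \<le> norm (K s * C)"
      using bound
    proof eventually_elim
      case (elim s)
      have "0 \<le> (\<integral>x. norm (h s x) \<partial>lborel)" by (intro Bochner_Integration.integral_nonneg) simp
      with elim show ?case by (auto simp: abs_mult intro!: mult_left_mono)
    qed
  qed measurable
  then show "integrable lborel (\<lambda>s. \<integral>x. norm (case (s, x) of (s, x) \<Rightarrow> K s *\<^sub>R h s x) \<partial>lborel)"
    by simp
qed

text \<open>
  On a domain of finite measure both statements follow from \<open>\<bar>y\<bar> \<le> \<bar>y\<bar>\<^sup>2 + 1\<close>. The crude bound is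
  enough for the integrability over time and space in Fubini's theorem.
\<close>
lemma L2_integrable:
  assumes \<Omega>: "\<Omega> \<in> lmeasurable" and v: "v \<in> L2 \<Omega>"
  shows "integrable (lebesgue_on \<Omega>) v"
    and "(\<integral>x. norm (v x) \<partial>lebesgue_on \<Omega>) \<le> L2_inner \<Omega> v v + measure (lebesgue_on \<Omega>) \<Omega>"
proof -
  interpret finite_measure "lebesgue_on \<Omega>" using \<Omega> by (rule finite_measure_lebesgue_on)
  have sq: "integrable (lebesgue_on \<Omega>) (\<lambda>x. v x \<bullet> v x + 1)"
    using L2_inner_integrable[OF v v] by simp
  have le: "norm (v x) \<le> v x \<bullet> v x + 1" for x
  proof -
    have "2 * norm (v x) * 1 \<le> (norm (v x))\<^sup>2 + 1\<^sup>2" by (rule sum_squares_bound)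
    then have "2 * norm (v x) \<le> v x \<bullet> v x + 1" by (simp add: power2_norm_eq_inner)
    then show ?thesis using norm_ge_zero[of "v x"] by linarith
  qed
  show int: "integrable (lebesgue_on \<Omega>) v"
    using sq L2_measurable[OF v]
  proof (rule Bochner_Integration.integrable_bound)
    show "AE x in lebesgue_on \<Omega>. norm (v x) \<le> norm (v x \<bullet> v x + 1)"
      using order_trans[OF le abs_ge_self] by (intro AE_I2) simp
  qed
  have "(\<integral>x. norm (v x) \<partial>lebesgue_on \<Omega>) \<le> (\<integral>x. v x \<bullet> v x + 1 \<partial>lebesgue_on \<Omega>)"
    using int sq le by (intro integral_mono) auto
  also have "\<dots> = L2_inner \<Omega> v v + measure (lebesgue_on \<Omega>) \<Omega>"
    using L2_inner_integrable[OF v v] by (simp add: L2_inner_def)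
  finally show "(\<integral>x. norm (v x) \<partial>lebesgue_on \<Omega>) \<le> L2_inner \<Omega> v v + measure (lebesgue_on \<Omega>) \<Omega>" .
qed

lemma L2_inner_abs_le:
  assumes "u \<in> L2 \<Omega>" "v \<in> L2 \<Omega>"
  shows "(\<integral>x. norm (u x \<bullet> v x) \<partial>lebesgue_on \<Omega>) \<le> L2_inner \<Omega> u u + L2_inner \<Omega> v v"
proof -
  have le: "norm (u x \<bullet> v x) \<le> u x \<bullet> u x + v x \<bullet> v x" for x
  proof -
    have "\<bar>u x \<bullet> v x\<bar> \<le> norm (u x) * norm (v x)" by (rule Cauchy_Schwarz_ineq2)
    moreover have "2 * norm (u x) * norm (v x) \<le> (norm (u x))\<^sup>2 + (norm (v x))\<^sup>2" by (rule sum_squares_bound)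
    moreover have "0 \<le> norm (u x) * norm (v x)" by simp
    ultimately show ?thesis by (simp add: power2_norm_eq_inner)
  qed
  have "(\<integral>x. norm (u x \<bullet> v x) \<partial>lebesgue_on \<Omega>) \<le> (\<integral>x. u x \<bullet> u x + v x \<bullet> v x \<partial>lebesgue_on \<Omega>)"
    using assms le by (intro integral_mono integrable_norm Bochner_Integration.integrable_add L2_inner_integrable)
  also have "\<dots> = L2_inner \<Omega> u u + L2_inner \<Omega> v v"
    using assms by (simp add: L2_inner_def L2_inner_integrable)
  finally show ?thesis .
qed

text \<open>
  Fubini's theorem for a fractional integral in time tested by \<open>\<psi>\<close> in space. It is applied twice,
  to Borel representatives: to \<open>K(s) f(s, x)\<close>, which shows that for almost every \<open>x\<close> the vector-valued
  time integral exists and may be paired with \<open>\<psi>(x)\<close>, and to \<open>K(s) (f(s, x) \<bullet> \<psi>(x))\<close>, for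
  exchanging the two integrals. Both are integrable since \<open>f\<close> is bounded in time with values in \<open>L\<^sup>2\<close>
  and \<open>K\<close> is integrable.
\<close>
lemma
  fixes f :: "real \<Rightarrow> 'a::euclidean_space \<Rightarrow> 'b::euclidean_space"
  assumes \<Omega>: "\<Omega> \<in> sets borel" and fin: "\<Omega> \<in> lmeasurable"
    and \<beta>: "0 < \<beta>" and t: "t \<in> {0..T}"
    and meas: "(\<lambda>(s, x). f s x) \<in> borel_measurable (lebesgue_on ({0..T} \<times> \<Omega>))"
    and mem: "\<And>s. s \<in> {0..T} \<Longrightarrow> f s \<in> L2 \<Omega>"
    and bound: "\<And>s. s \<in> {0..T} \<Longrightarrow> L2_inner \<Omega> (f s) (f s) \<le> M"
    and \<psi>: "\<psi> \<in> L2 \<Omega>"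
  shows integrable_RL_integral_inner:
      "integrable (lebesgue_on \<Omega>) (\<lambda>x. RL_integral \<beta> (\<lambda>s. f s x) t \<bullet> \<psi> x)"
    and L2_inner_RL_integral:
      "L2_inner \<Omega> (\<lambda>x. RL_integral \<beta> (\<lambda>s. f s x) t) \<psi> = RL_integral \<beta> (\<lambda>s. L2_inner \<Omega> (f s) \<psi>) t"
proof -
  have \<Omega>L: "\<Omega> \<in> sets lebesgue" using \<Omega> by simp
  have G0: "Gamma \<beta> \<noteq> 0" using Gamma_real_pos[OF \<beta>] by linarith
  have M0: "0 \<le> M" using bound[OF t] L2_inner_nonneg[of \<Omega> "f t"] by linarith
  let ?D = "{0..T} \<times> \<Omega>"
  have "?D \<in> sets borel" using \<Omega> by (intro borel_Times) auto
  then have D: "?D \<in> sets lebesgue" by simp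
  have "(\<lambda>z. if z \<in> ?D then (case z of (s, x) \<Rightarrow> f s x) else 0) \<in> borel_measurable lebesgue"
    using meas borel_measurable_if[OF D] by blast
  then obtain G where G: "G \<in> borel_measurable borel"
    and aeG: "AE z in lborel. (if z \<in> ?D then (case z of (s, x) \<Rightarrow> f s x) else 0) = G z"
    by (rule lebesgue_ex_borel)
  have [measurable]: "G \<in> borel_measurable (borel \<Otimes>\<^sub>M borel)" using G by (simp add: borel_prod)
  have [measurable]: "\<Omega> \<in> sets borel" by fact
  define g where "g s x = (if s \<in> {0..T} \<and> x \<in> \<Omega> then G (s, x) else 0)" for s x
  have g_meas: "(\<lambda>(s, x). g s x) \<in> borel_measurable (lborel \<Otimes>\<^sub>M lborel)"
    unfolding g_def by measurable
  have g_slice: "(\<lambda>s. g s x) \<in> borel_measurable borel" "g s \<in> borel_measurable borel" for s x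
    unfolding g_def[abs_def] by measurable
  have aeg: "AE z in lborel. (if fst z \<in> {0..T} \<and> snd z \<in> \<Omega> then f (fst z) (snd z) else 0) = g (fst z) (snd z)"
    using aeG by eventually_elim (auto simp: g_def split: if_splits)
  note ae1 = AE_lborel_pair(1)[OF aeg] and ae2 = AE_lborel_pair(2)[OF aeg]
  have "(\<lambda>x. if x \<in> \<Omega> then \<psi> x else 0) \<in> borel_measurable lebesgue"
    using L2_measurable[OF \<psi>] borel_measurable_if[OF \<Omega>L] by blast
  then obtain \<phi> where \<phi>: "\<phi> \<in> borel_measurable borel" and ae\<phi>: "AE x in lborel. (if x \<in> \<Omega> then \<psi> x else 0) = \<phi> x"
    by (rule lebesgue_ex_borel)
  note [measurable] = \<phi>
  have gout: "g s x = 0" if "s \<notin> {0..T} \<or> x \<notin> \<Omega>" for s x using that by (auto simp: g_def)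
  have slice: "integrable lborel (g s) \<and> (\<integral>x. norm (g s x) \<partial>lborel) \<le> M + measure (lebesgue_on \<Omega>) \<Omega>
      \<and> integrable lborel (\<lambda>x. g s x \<bullet> \<phi> x) \<and> (\<integral>x. norm (g s x \<bullet> \<phi> x) \<partial>lborel) \<le> M + L2_inner \<Omega> \<psi> \<psi>
      \<and> (s \<in> {0..T} \<longrightarrow> (\<integral>x. g s x \<bullet> \<phi> x \<partial>lborel) = L2_inner \<Omega> (f s) \<psi>)"
    if ae: "AE x in lborel. (if s \<in> {0..T} \<and> x \<in> \<Omega> then f s x else 0) = g s x" for s
  proof (cases "s \<in> {0..T}")
    case False
    then have "g s = (\<lambda>_. 0)" by (auto simp: g_def)
    then show ?thesis using False M0 L2_inner_nonneg[of \<Omega> \<psi>] by auto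
  next
    case True
    have r1: "AE x in lborel. (if x \<in> \<Omega> then f s x else 0) = g s x"
      using ae True by simp
    have r2: "AE x in lborel. (if x \<in> \<Omega> then norm (f s x) else 0) = norm (g s x)"
      using r1 by eventually_elim (auto split: if_splits)
    have r3: "AE x in lborel. (if x \<in> \<Omega> then f s x \<bullet> \<psi> x else 0) = g s x \<bullet> \<phi> x"
      using r1 ae\<phi> by eventually_elim (auto split: if_splits)
    have r4: "AE x in lborel. (if x \<in> \<Omega> then norm (f s x \<bullet> \<psi> x) else 0) = norm (g s x \<bullet> \<phi> x)"
      using r3 by eventually_elim (auto split: if_splits)
    have m: "(\<lambda>x. norm (g s x)) \<in> borel_measurable borel" "(\<lambda>x. g s x \<bullet> \<phi> x) \<in> borel_measurable borel"
        "(\<lambda>x. norm (g s x \<bullet> \<phi> x)) \<in> borel_measurable borel"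
      using g_slice(2)[of s] \<phi> by measurable
    note rep = lebesgue_on_integral_borel_representative[OF \<Omega>L]
    have "integrable lborel (g s)"
      using rep(1)[OF g_slice(2) r1] L2_integrable(1)[OF fin mem[OF True]] by simp
    moreover have "(\<integral>x. norm (g s x) \<partial>lborel) \<le> M + measure (lebesgue_on \<Omega>) \<Omega>"
      using rep(2)[OF m(1) r2] L2_integrable(2)[OF fin mem[OF True]] bound[OF True] by simp
    moreover have "integrable lborel (\<lambda>x. g s x \<bullet> \<phi> x)"
      using rep(1)[OF m(2) r3] L2_inner_integrable[OF mem[OF True] \<psi>] by simp
    moreover have "(\<integral>x. norm (g s x \<bullet> \<phi> x) \<partial>lborel) \<le> M + L2_inner \<Omega> \<psi> \<psi>"
      using rep(2)[OF m(3) r4] L2_inner_abs_le[OF mem[OF True] \<psi>] bound[OF True] by simp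
    moreover have "(\<integral>x. g s x \<bullet> \<phi> x \<partial>lborel) = L2_inner \<Omega> (f s) \<psi>"
      using rep(2)[OF m(2) r3] by (simp add: L2_inner_def)
    ultimately show ?thesis by simp
  qed
  define K where "K s = frac_kernel \<beta> t (t - s)" for s
  have K: "integrable lborel K"
    using lborel_integrable_real_affine[OF frac_kernel_integrable[OF \<beta>, of t], of "-1" t] t
    by (simp add: K_def[abs_def])
  have [measurable]: "K \<in> borel_measurable borel" unfolding K_def[abs_def] by measurable
  have K_eq: "Gamma \<beta> * K s = indicator {0..t} s * (t - s) powr (\<beta> - 1)" for s
    using G0 by (auto simp: K_def frac_kernel_def indicator_def)
  have F1: "integrable (lborel \<Otimes>\<^sub>M lborel) (\<lambda>(s, x). K s *\<^sub>R g s x)"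
    using ae1 slice
    by (intro integrable_weighted_slices[OF K g_meas, of "M + measure (lebesgue_on \<Omega>) \<Omega>"])
      (auto elim!: eventually_mono)
  have F2: "integrable (lborel \<Otimes>\<^sub>M lborel) (\<lambda>(s, x). K s *\<^sub>R (g s x \<bullet> \<phi> x))"
  proof (rule integrable_weighted_slices[OF K, of _ "M + L2_inner \<Omega> \<psi> \<psi>"])
    note [measurable] = g_meas
    show "(\<lambda>(s, x). g s x \<bullet> \<phi> x) \<in> borel_measurable (lborel \<Otimes>\<^sub>M lborel)" by measurable
  qed (use ae1 slice in \<open>auto elim!: eventually_mono\<close>)
  have RL: "AE x in lborel. (if x \<in> \<Omega> then RL_integral \<beta> (\<lambda>s. f s x) t \<bullet> \<psi> x else 0)
      = (\<integral>s. K s *\<^sub>R (g s x \<bullet> \<phi> x) \<partial>lborel)"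
    using lborel_pair.AE_integrable_snd[OF F1] ae2 ae\<phi>
  proof eventually_elim
    case (elim x)
    show ?case
    proof (cases "x \<in> \<Omega>")
      case False
      then show ?thesis by (simp add: gout)
    next
      case True
      have "AE s in lborel. indicator {0..t} s *\<^sub>R ((t - s) powr (\<beta> - 1)) *\<^sub>R f s x = Gamma \<beta> *\<^sub>R K s *\<^sub>R g s x"
        using elim(2)
      proof eventually_elim
        case (elim s)
        have "indicator {0..t} s *\<^sub>R ((t - s) powr (\<beta> - 1)) *\<^sub>R f s x = (Gamma \<beta> * K s) *\<^sub>R f s x"
          by (simp add: K_eq)
        also have "\<dots> = (Gamma \<beta> * K s) *\<^sub>R g s x"
        proof (cases "s \<in> {0..t}")
          case True
          then show ?thesis using elim t \<open>x \<in> \<Omega>\<close> by simp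
        qed (simp add: K_eq)
        finally show ?case by simp
      qed
      moreover have "(\<lambda>s. Gamma \<beta> *\<^sub>R K s *\<^sub>R g s x) \<in> borel_measurable borel"
        using g_slice(1)[of x] by measurable
      ultimately have "RL_integral \<beta> (\<lambda>s. f s x) t = (1 / Gamma \<beta>) *\<^sub>R (\<integral>s. Gamma \<beta> *\<^sub>R K s *\<^sub>R g s x \<partial>lborel)"
        unfolding RL_integral_def set_lebesgue_integral_def
        by (subst lebesgue_integral_borel_representative(3)) auto
      also have "(\<integral>s. Gamma \<beta> *\<^sub>R K s *\<^sub>R g s x \<partial>lborel) = Gamma \<beta> *\<^sub>R (\<integral>s. K s *\<^sub>R g s x \<partial>lborel)"
        by (rule integral_scaleR_right)
      also have "(1 / Gamma \<beta>) *\<^sub>R Gamma \<beta> *\<^sub>R (\<integral>s. K s *\<^sub>R g s x \<partial>lborel) = (\<integral>s. K s *\<^sub>R g s x \<partial>lborel)"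
        using G0 by simp
      finally have "RL_integral \<beta> (\<lambda>s. f s x) t \<bullet> \<phi> x = (\<integral>s. K s *\<^sub>R g s x \<partial>lborel) \<bullet> \<phi> x"
        by simp
      also have "\<dots> = (\<integral>s. (K s *\<^sub>R g s x) \<bullet> \<phi> x \<partial>lborel)"
        by (rule integral_inner_left[symmetric]) (use elim(1) in simp)
      finally have "RL_integral \<beta> (\<lambda>s. f s x) t \<bullet> \<phi> x = (\<integral>s. (K s *\<^sub>R g s x) \<bullet> \<phi> x \<partial>lborel)" .
      then show ?thesis using elim(3) True by simp
    qed
  qed
  note int2 = lborel_pair.integrable_snd[OF F2]
  have meas2: "(\<lambda>x. \<integral>s. K s *\<^sub>R (g s x \<bullet> \<phi> x) \<partial>lborel) \<in> borel_measurable borel"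
    using borel_measurable_integrable[OF int2] by simp
  show "integrable (lebesgue_on \<Omega>) (\<lambda>x. RL_integral \<beta> (\<lambda>s. f s x) t \<bullet> \<psi> x)"
    using lebesgue_on_integral_borel_representative(1)[OF \<Omega>L meas2 RL] int2 by blast
  have "L2_inner \<Omega> (\<lambda>x. RL_integral \<beta> (\<lambda>s. f s x) t) \<psi> = (\<integral>x. (\<integral>s. K s *\<^sub>R (g s x \<bullet> \<phi> x) \<partial>lborel) \<partial>lborel)"
    unfolding L2_inner_def by (rule lebesgue_on_integral_borel_representative(2)[OF \<Omega>L meas2 RL])
  also have "\<dots> = (\<integral>s. (\<integral>x. K s *\<^sub>R (g s x \<bullet> \<phi> x) \<partial>lborel) \<partial>lborel)"
    by (rule lborel_pair.Fubini_integral[OF F2])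
  also have "\<dots> = RL_integral \<beta> (\<lambda>s. L2_inner \<Omega> (f s) \<psi>) t"
  proof -
    have ae: "AE s in lborel. indicator {0..t} s *\<^sub>R ((t - s) powr (\<beta> - 1)) *\<^sub>R L2_inner \<Omega> (f s) \<psi>
        = Gamma \<beta> * (\<integral>x. K s *\<^sub>R (g s x \<bullet> \<phi> x) \<partial>lborel)"
      using ae1
    proof eventually_elim
      case (elim s)
      have "Gamma \<beta> * (\<integral>x. K s *\<^sub>R (g s x \<bullet> \<phi> x) \<partial>lborel) = (Gamma \<beta> * K s) * (\<integral>x. g s x \<bullet> \<phi> x \<partial>lborel)"
        by simp
      also have "\<dots> = (Gamma \<beta> * K s) * L2_inner \<Omega> (f s) \<psi>"
      proof (cases "s \<in> {0..t}")
        case True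
        then show ?thesis using slice[OF elim] t by simp
      qed (simp add: K_eq)
      finally show ?case by (simp add: K_eq)
    qed
    have "(\<lambda>s. Gamma \<beta> * (\<integral>x. K s *\<^sub>R (g s x \<bullet> \<phi> x) \<partial>lborel)) \<in> borel_measurable borel"
      using borel_measurable_integrable[OF lborel_pair.integrable_fst[OF F2]] by simp
    from lebesgue_integral_borel_representative(3)[OF this ae]
    show ?thesis
      using G0 unfolding RL_integral_def set_lebesgue_integral_def by simp
  qed
  finally show "L2_inner \<Omega> (\<lambda>x. RL_integral \<beta> (\<lambda>s. f s x) t) \<psi> = RL_integral \<beta> (\<lambda>s. L2_inner \<Omega> (f s) \<psi>) t" .
qed

text \<open>
  Testing with the bounded field \<open>sgn (u - v)\<close> gives \<open>\<integral> \<bar>u - v\<bar> = 0\<close>. The point is that \<open>u\<close> is not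
  known to lie in \<open>L\<^sup>2\<close> beforehand; this is a consequence.
\<close>
lemma AE_eq_if_L2_inner_eq:
  fixes u v :: "'a::euclidean_space \<Rightarrow> 'b::euclidean_space"
  assumes fin: "\<Omega> \<in> lmeasurable" and v: "v \<in> L2 \<Omega>"
    and int: "\<And>\<psi>. \<psi> \<in> L2 \<Omega> \<Longrightarrow> integrable (lebesgue_on \<Omega>) (\<lambda>x. u x \<bullet> \<psi> x)"
    and eq: "\<And>\<psi>. \<psi> \<in> L2 \<Omega> \<Longrightarrow> L2_inner \<Omega> u \<psi> = L2_inner \<Omega> v \<psi>"
  shows "AE x in lebesgue_on \<Omega>. u x = v x" and "L2_norm \<Omega> u = L2_norm \<Omega> v"
proof -
  interpret finite_measure "lebesgue_on \<Omega>" using fin by (rule finite_measure_lebesgue_on)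
  have "(\<lambda>x. u x \<bullet> b) \<in> borel_measurable (lebesgue_on \<Omega>)" for b
    using int[of "\<lambda>_. b"] by (intro borel_measurable_integrable) (simp add: L2_def)
  then have [measurable]: "u \<in> borel_measurable (lebesgue_on \<Omega>)"
    by (subst borel_measurable_euclidean_space) auto
  note [measurable] = L2_measurable[OF v]
  define \<psi> where "\<psi> x = sgn (u x - v x)" for x
  have \<psi>: "\<psi> \<in> L2 \<Omega>"
  proof -
    have "integrable (lebesgue_on \<Omega>) (\<lambda>x. (norm (sgn (u x - v x)))\<^sup>2)"
    proof (rule integrable_const_bound[of _ 1])
      show "(\<lambda>x. (norm (sgn (u x - v x)))\<^sup>2) \<in> borel_measurable (lebesgue_on \<Omega>)"
        unfolding sgn_div_norm by measurable
    qed (simp add: norm_sgn)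
    moreover have "\<psi> \<in> borel_measurable (lebesgue_on \<Omega>)"
      unfolding \<psi>_def[abs_def] sgn_div_norm by measurable
    ultimately show ?thesis by (simp add: L2_def \<psi>_def)
  qed
  have norm_eq: "norm (u x - v x) = u x \<bullet> \<psi> x - v x \<bullet> \<psi> x" for x
  proof -
    have "u x \<bullet> \<psi> x - v x \<bullet> \<psi> x = (u x - v x) \<bullet> ((u x - v x) /\<^sub>R norm (u x - v x))"
      by (simp add: \<psi>_def sgn_div_norm inner_diff_left right_diff_distrib)
    also have "\<dots> = norm (u x - v x)"
      by (cases "u x - v x = 0") (simp_all add: power2_norm_eq_inner[symmetric] power2_eq_square)
    finally show ?thesis ..
  qed
  have i: "integrable (lebesgue_on \<Omega>) (\<lambda>x. norm (u x - v x))"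
    unfolding norm_eq using int[OF \<psi>] L2_inner_integrable[OF v \<psi>] by simp
  have "(\<integral>x. norm (u x - v x) \<partial>lebesgue_on \<Omega>) = 0"
    unfolding norm_eq using int[OF \<psi>] L2_inner_integrable[OF v \<psi>] eq[OF \<psi>] by (simp add: L2_inner_def)
  then have "AE x in lebesgue_on \<Omega>. norm (u x - v x) = 0"
    using integral_nonneg_eq_0_iff_AE[OF i] by simp
  then show ae: "AE x in lebesgue_on \<Omega>. u x = v x" by eventually_elim simp
  have "L2_inner \<Omega> u u = L2_inner \<Omega> v v"
    unfolding L2_inner_def
  proof (rule integral_cong_AE)
    show "AE x in lebesgue_on \<Omega>. u x \<bullet> u x = v x \<bullet> v x" using ae by eventually_elim simp
  qed measurable
  then show "L2_norm \<Omega> u = L2_norm \<Omega> v" by (simp add: L2_norm_def)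
qed

section \<open>Energy dissipation\<close>

theorem lemma2p2:
  fixes a b c d :: real and \<Omega> :: "(real \<times> real) set"
    and \<alpha> T \<epsilon>\<^sub>0 \<epsilon>\<^sub>i \<epsilon>\<^sub>s \<mu>\<^sub>0 \<tau>\<^sub>0 :: real
    and E E' P P' :: "real \<Rightarrow> real \<times> real \<Rightarrow> real \<times> real"
    and H H' :: "real \<Rightarrow> real \<times> real \<Rightarrow> real"
    and E\<^sub>0 :: "real \<times> real \<Rightarrow> real \<times> real" and H\<^sub>0 :: "real \<times> real \<Rightarrow> real"
  assumes domain: "a < b" "c < d" "\<Omega> = {a<..<b} \<times> {c<..<d}"
    and order: "0 < \<alpha>" "\<alpha> < 1"
    and final_time: "0 < T"
    and constants: "0 < \<epsilon>\<^sub>0" "0 < \<epsilon>\<^sub>i" "0 < \<epsilon>\<^sub>s" "0 < \<mu>\<^sub>0" "0 < \<tau>\<^sub>0" "\<epsilon>\<^sub>i < \<epsilon>\<^sub>s"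
    and E_regular: "C0_into (H0curl \<Omega>) (Hcurl_norm \<Omega>) T E"
                   "C1_into (L2 \<Omega>) (L2_norm \<Omega>) T E E'"
    and H_regular: "C1_into (L2 \<Omega>) (L2_norm \<Omega>) T H H'"
    and P_regular: "C1_into (L2 \<Omega>) (L2_norm \<Omega>) T P P'"
    and P'_measurable: "(\<lambda>(t, x). P' t x) \<in> borel_measurable (lebesgue_on ({0..T} \<times> \<Omega>))"
    and eq_E: "\<And>t v. t \<in> {0<..<T} \<Longrightarrow> v \<in> H0curl \<Omega> \<Longrightarrow>
        \<epsilon>\<^sub>0 * \<epsilon>\<^sub>i * L2_inner \<Omega> (E' t) v + L2_inner \<Omega> (P' t) v - L2_inner \<Omega> (H t) (curl \<Omega> v) = 0"
    and eq_H: "\<And>t \<phi>. t \<in> {0<..<T} \<Longrightarrow> \<phi> \<in> L2 \<Omega> \<Longrightarrow>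
        \<mu>\<^sub>0 * L2_inner \<Omega> (H' t) \<phi> + L2_inner \<Omega> (curl \<Omega> (E t)) \<phi> = 0"
    and eq_P: "\<And>t \<psi>. t \<in> {0<..<T} \<Longrightarrow> \<psi> \<in> L2 \<Omega> \<Longrightarrow>
        \<tau>\<^sub>0 powr \<alpha> * L2_inner \<Omega> (caputo \<alpha> P' t) \<psi> + L2_inner \<Omega> (P t) \<psi>
          - \<epsilon>\<^sub>0 * (\<epsilon>\<^sub>s - \<epsilon>\<^sub>i) * L2_inner \<Omega> (E t) \<psi> = 0"
    and initial: "AE x in lebesgue_on \<Omega>. E 0 x = E\<^sub>0 x"
                 "AE x in lebesgue_on \<Omega>. H 0 x = H\<^sub>0 x"
                 "AE x in lebesgue_on \<Omega>. P 0 x = 0"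
    and P'_L1: "AE x in lebesgue_on \<Omega>. set_integrable lebesgue {0<..<T} (\<lambda>t. P' t x)"
    and caputo_continuous: "AE x in lebesgue_on \<Omega>. \<exists>w. continuous_on {0..T} w \<and>
        (AE t in lebesgue_on {0..T}. caputo \<alpha> P' t x = w t)"
  shows "(\<forall>t \<in> {0<..<T}.
            energy \<Omega> \<alpha> \<epsilon>\<^sub>0 \<epsilon>\<^sub>i \<epsilon>\<^sub>s \<mu>\<^sub>0 \<tau>\<^sub>0 E H P P' differentiable (at t) \<and>
            deriv (energy \<Omega> \<alpha> \<epsilon>\<^sub>0 \<epsilon>\<^sub>i \<epsilon>\<^sub>s \<mu>\<^sub>0 \<tau>\<^sub>0 E H P P') t
              + \<tau>\<^sub>0 powr \<alpha> * eta \<alpha> t * (L2_norm \<Omega> (caputo \<alpha> P' t))\<^sup>2 \<le> 0)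
       \<and> (\<forall>t\<^sub>1 \<in> {0..T}. \<forall>t\<^sub>2 \<in> {0..T}. t\<^sub>1 \<ge> t\<^sub>2 \<longrightarrow>
            energy \<Omega> \<alpha> \<epsilon>\<^sub>0 \<epsilon>\<^sub>i \<epsilon>\<^sub>s \<mu>\<^sub>0 \<tau>\<^sub>0 E H P P' t\<^sub>1
              \<le> energy \<Omega> \<alpha> \<epsilon>\<^sub>0 \<epsilon>\<^sub>i \<epsilon>\<^sub>s \<mu>\<^sub>0 \<tau>\<^sub>0 E H P P' t\<^sub>2)"
proof -
  define \<kappa> where "\<kappa> = \<epsilon>\<^sub>0 * (\<epsilon>\<^sub>s - \<epsilon>\<^sub>i)"
  define A where "A = \<tau>\<^sub>0 powr \<alpha>"
  have A: "0 < A" using constants by (simp add: A_def)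
  have \<Omega>_box: "\<Omega> = box (a, c) (b, d)" unfolding domain(3) by (auto simp: box_def Basis_prod_def)
  have \<Omega>_borel: "\<Omega> \<in> sets borel" and \<Omega>_fin: "\<Omega> \<in> lmeasurable" unfolding \<Omega>_box by auto
  define w where "w = (\<lambda>t x. (\<kappa> / A) *\<^sub>R E t x + (- 1 / A) *\<^sub>R P t x)"
  define w' where "w' = (\<lambda>t x. (\<kappa> / A) *\<^sub>R E' t x + (- 1 / A) *\<^sub>R P' t x)"
  have w_C1: "C1_into (L2 \<Omega>) (L2_norm \<Omega>) T w w'"
    unfolding w_def w'_def using E_regular(2) P_regular by (rule C1_into_lincomb)
  have C0: "C0_into (L2 \<Omega>) (L2_norm \<Omega>) T E" "C0_into (L2 \<Omega>) (L2_norm \<Omega>) T H"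
    "C0_into (L2 \<Omega>) (L2_norm \<Omega>) T P" "C0_into (L2 \<Omega>) (L2_norm \<Omega>) T P'"
    "C0_into (L2 \<Omega>) (L2_norm \<Omega>) T w" "C0_into (L2 \<Omega>) (L2_norm \<Omega>) T w'"
    using E_regular H_regular P_regular w_C1 unfolding C1_into_def by blast+
  have mem: "E t \<in> L2 \<Omega>" "H t \<in> L2 \<Omega>" "P t \<in> L2 \<Omega>" "P' t \<in> L2 \<Omega>" "w t \<in> L2 \<Omega>" "w' t \<in> L2 \<Omega>"
    if "t \<in> {0..T}" for t
    using that C0 unfolding C0_into_def by blast+
  have A_w: "A * L2_inner \<Omega> (w t) \<psi> = \<kappa> * L2_inner \<Omega> (E t) \<psi> - L2_inner \<Omega> (P t) \<psi>"
    if "t \<in> {0..T}" "\<psi> \<in> L2 \<Omega>" for t \<psi>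
    unfolding w_def L2_inner_lincomb_left[OF mem(1)[OF that(1)] mem(3)[OF that(1)] that(2)]
    using A by (simp add: field_simps)

  obtain M where M: "\<And>s. s \<in> {0..T} \<Longrightarrow> L2_inner \<Omega> (P' s) (P' s) \<le> M"
  proof -
    have "bounded ((\<lambda>s. L2_inner \<Omega> (P' s) (P' s)) ` {0..T})"
      by (intro compact_imp_bounded compact_continuous_image continuous_on_L2_inner C0) auto
    then show ?thesis using that unfolding bounded_iff by (metis abs_le_D1 imageI real_norm_def)
  qed
  have caputo_eq: "caputo \<alpha> P' t = (\<lambda>x. RL_integral (1 - \<alpha>) (\<lambda>s. P' s x) t)" for t
    by (auto simp: caputo_def)
  have caputo_integrable: "integrable (lebesgue_on \<Omega>) (\<lambda>x. caputo \<alpha> P' t x \<bullet> \<psi> x)"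
    and caputo_inner: "L2_inner \<Omega> (caputo \<alpha> P' t) \<psi> = RL_integral (1 - \<alpha>) (\<lambda>s. L2_inner \<Omega> (P' s) \<psi>) t"
    if "t \<in> {0..T}" "\<psi> \<in> L2 \<Omega>" for t \<psi>
  proof -
    have "0 < 1 - \<alpha>" using order by simp
    note Fubini = \<Omega>_borel \<Omega>_fin this that(1) P'_measurable mem(4) M that(2)
    show "integrable (lebesgue_on \<Omega>) (\<lambda>x. caputo \<alpha> P' t x \<bullet> \<psi> x)"
      unfolding caputo_eq by (rule integrable_RL_integral_inner[OF Fubini])
    show "L2_inner \<Omega> (caputo \<alpha> P' t) \<psi> = RL_integral (1 - \<alpha>) (\<lambda>s. L2_inner \<Omega> (P' s) \<psi>) t"
      unfolding caputo_eq by (rule L2_inner_RL_integral[OF Fubini])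
  qed
  have caputo_w: "L2_inner \<Omega> (caputo \<alpha> P' t) \<psi> = L2_inner \<Omega> (w t) \<psi>"
    if "t \<in> {0<..<T}" "\<psi> \<in> L2 \<Omega>" for t \<psi>
  proof -
    have "A * L2_inner \<Omega> (caputo \<alpha> P' t) \<psi> = A * L2_inner \<Omega> (w t) \<psi>"
      using eq_P[OF that] A_w[of t \<psi>] that by (simp add: A_def \<kappa>_def)
    then show ?thesis using A by simp
  qed
  \<comment> \<open>The constitutive law identifies the pointwise Caputo derivative with \<open>w\<close> almost everywhere.\<close>
  have norm_caputo: "L2_norm \<Omega> (caputo \<alpha> P' t) = L2_norm \<Omega> (w t)" if "t \<in> {0<..<T}" for t
    using that by (intro AE_eq_if_L2_inner_eq(2)[OF \<Omega>_fin] mem caputo_integrable caputo_w) auto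

  have cont_inner: "continuous_on {0..T} (\<lambda>s. L2_inner \<Omega> (u s) \<psi>)"
    if "C0_into (L2 \<Omega>) (L2_norm \<Omega>) T u" "\<psi> \<in> L2 \<Omega>" for u :: "real \<Rightarrow> real \<times> real \<Rightarrow> real \<times> real" and \<psi>
    using that by (intro continuous_on_L2_inner C0_into_const)
  \<comment> \<open>The law is known for interior times only; continuity of both sides extends the identity to the
    end points. At \<open>t = 0\<close> it yields the initial value of \<open>w\<close>.\<close>
  have w_RL: "L2_inner \<Omega> (w t) \<psi> = RL_integral (1 - \<alpha>) (\<lambda>s. L2_inner \<Omega> (P' s) \<psi>) t"
    if t: "t \<in> {0..T}" and \<psi>: "\<psi> \<in> L2 \<Omega>" for t \<psi>
  proof -
    let ?d = "\<lambda>t. L2_inner \<Omega> (w t) \<psi> - RL_integral (1 - \<alpha>) (\<lambda>s. L2_inner \<Omega> (P' s) \<psi>) t"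
    have "continuous_on {0..T} ?d"
      using order final_time \<psi> C0
      by (intro continuous_on_diff continuous_on_RL_integral cont_inner) auto
    then have "continuous_on (closure {0<..<T}) ?d" using final_time by simp
    moreover have "?d s = 0" if "s \<in> {0<..<T}" for s
      using caputo_w[OF that \<psi>] caputo_inner[of s \<psi>] that \<psi> by simp
    ultimately have "?d t = 0"
      by (rule continuous_constant_on_closure) (use t final_time in auto)
    then show ?thesis by simp
  qed
  have w0: "L2_inner \<Omega> (w 0) \<psi> = 0" if "\<psi> \<in> L2 \<Omega>" for \<psi>
    using w_RL[OF _ that, of 0] final_time by (simp add: RL_integral_0)
  have N0: "L2_inner \<Omega> (w 0) (w 0) = 0" using final_time by (intro w0 mem) auto

  \<comment> \<open>The weak form of \<open>P' = I\<^sup>\<alpha> w'\<close>.\<close>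
  have P'_RL: "RL_integral \<alpha> (\<lambda>s. L2_inner \<Omega> (w' s) \<psi>) t = L2_inner \<Omega> (P' t) \<psi>"
    if t: "t \<in> {0<..<T}" and \<psi>: "\<psi> \<in> L2 \<Omega>" for t \<psi>
  proof (rule RL_integral_deriv_inverse[OF order t])
    have zero: "L2_inner \<Omega> u (\<lambda>_. 0) = 0" for u :: "real \<times> real \<Rightarrow> real \<times> real"
      by (simp add: L2_inner_def)
    show "((\<lambda>s. L2_inner \<Omega> (P s) \<psi>) has_real_derivative L2_inner \<Omega> (P' s) \<psi>) (at s within {0..T})"
      if "s \<in> {0..T}" for s
      using has_derivative_L2_inner[OF P_regular C1_into_const[OF \<psi>] that] by (simp add: zero)
    show "((\<lambda>s. L2_inner \<Omega> (w s) \<psi>) has_real_derivative L2_inner \<Omega> (w' s) \<psi>) (at s within {0..T})"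
      if "s \<in> {0..T}" for s
      using has_derivative_L2_inner[OF w_C1 C1_into_const[OF \<psi>] that] by (simp add: zero)
  qed (use cont_inner C0 \<psi> w_RL in auto)

  \<comment> \<open>The energy with the Caputo derivative replaced by the differentiable field \<open>w\<close>.\<close>
  define e where "e t = A * RL_integral \<alpha> (\<lambda>s. L2_inner \<Omega> (w s) (w s)) t + L2_inner \<Omega> (P t) (P t)
    + \<kappa> * (\<epsilon>\<^sub>0 * \<epsilon>\<^sub>i * L2_inner \<Omega> (E t) (E t) + \<mu>\<^sub>0 * L2_inner \<Omega> (H t) (H t))" for t
  let ?en = "energy \<Omega> \<alpha> \<epsilon>\<^sub>0 \<epsilon>\<^sub>i \<epsilon>\<^sub>s \<mu>\<^sub>0 \<tau>\<^sub>0 E H P P'"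
  have energy_e: "?en t = e t" if t: "t \<in> {0..T}" for t
  proof -
    have "RL_integral \<alpha> (\<lambda>s. (L2_norm \<Omega> (caputo \<alpha> P' s))\<^sup>2) t = RL_integral \<alpha> (\<lambda>s. L2_inner \<Omega> (w s) (w s)) t"
    proof (rule RL_integral_cong)
      fix s assume s: "s \<in> {0..<t}"
      show "(L2_norm \<Omega> (caputo \<alpha> P' s))\<^sup>2 = L2_inner \<Omega> (w s) (w s)"
      proof (cases "s = 0")
        case True
        have "L2_norm \<Omega> (caputo \<alpha> P' 0) = 0"
          by (simp add: caputo_eq RL_integral_0 L2_norm_def L2_inner_def)
        then show ?thesis using True N0 by simp
      next
        case False
        then show ?thesis using norm_caputo[of s] s t by (simp add: L2_norm_power2)
      qed
    qed
    then show ?thesis by (simp add: energy_def e_def A_def \<kappa>_def L2_norm_power2)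
  qed
  have cont_N: "continuous_on {0..T} (\<lambda>s. L2_inner \<Omega> (w s) (w s))"
    by (intro continuous_on_L2_inner C0)
  have "continuous_on {0..T} e"
    unfolding e_def[abs_def] using order final_time
    by (intro continuous_on_add continuous_on_mult continuous_on_const continuous_on_RL_integral
        continuous_on_L2_inner C0) auto
  then have cont_energy: "continuous_on {0..T} ?en"
    by (rule continuous_on_eq) (rule energy_e[symmetric])

  have dissipation: "\<exists>D. (?en has_real_derivative D) (at t) \<and> D + A * eta \<alpha> t * (L2_norm \<Omega> (caputo \<alpha> P' t))\<^sup>2 \<le> 0"
    if t: "t \<in> {0<..<T}" for t
  proof -
    have t': "t \<in> {0..T}" using t by simp
    let ?N' = "\<lambda>s. L2_inner \<Omega> (w' s) (w s) + L2_inner \<Omega> (w s) (w' s)"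
    have at_t: "at t within {0..T} = at t" using t by (intro at_within_Icc_at) auto
    note product_rule = has_derivative_L2_inner[of \<Omega> T, where t = t, unfolded at_t]
    have "(RL_integral \<alpha> (\<lambda>s. L2_inner \<Omega> (w s) (w s)) has_real_derivative RL_integral \<alpha> ?N' t) (at t)"
      by (intro RL_integral_has_derivative[OF order(1) t] has_derivative_L2_inner w_C1 N0
          continuous_on_add continuous_on_L2_inner C0)
    note ders = this product_rule[OF P_regular P_regular t'] product_rule[OF E_regular(2) E_regular(2) t']
      product_rule[OF H_regular H_regular t']
    let ?D = "A * RL_integral \<alpha> ?N' t + (L2_inner \<Omega> (P' t) (P t) + L2_inner \<Omega> (P t) (P' t))
      + \<kappa> * (\<epsilon>\<^sub>0 * \<epsilon>\<^sub>i * (L2_inner \<Omega> (E' t) (E t) + L2_inner \<Omega> (E t) (E' t))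
        + \<mu>\<^sub>0 * (L2_inner \<Omega> (H' t) (H t) + L2_inner \<Omega> (H t) (H' t)))"
    have "(e has_real_derivative ?D) (at t)"
      unfolding e_def[abs_def] by (intro DERIV_add DERIV_cmult ders)
    then have "(?en has_real_derivative ?D) (at t)"
      by (rule has_field_derivative_transform_within_open[of _ _ _ "{0<..<T}"])
        (use t energy_e in auto)
    moreover have "?D + A * eta \<alpha> t * (L2_norm \<Omega> (caputo \<alpha> P' t))\<^sup>2 \<le> 0"
    proof -
      \<comment> \<open>The choices \<open>v = E t\<close> and \<open>\<phi> = H t\<close> cancel the two curl terms.\<close>
      have "E t \<in> H0curl \<Omega>" using E_regular(1) t' unfolding C0_into_def by blast
      then have "\<epsilon>\<^sub>0 * \<epsilon>\<^sub>i * L2_inner \<Omega> (E' t) (E t) + L2_inner \<Omega> (P' t) (E t)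
          - L2_inner \<Omega> (H t) (curl \<Omega> (E t)) = 0"
        by (rule eq_E[OF t])
      moreover have "\<mu>\<^sub>0 * L2_inner \<Omega> (H' t) (H t) + L2_inner \<Omega> (H t) (curl \<Omega> (E t)) = 0"
        using eq_H[OF t mem(2)[OF t']] by (simp add: L2_inner_commute)
      ultimately have Maxwell: "\<epsilon>\<^sub>0 * \<epsilon>\<^sub>i * L2_inner \<Omega> (E' t) (E t) + \<mu>\<^sub>0 * L2_inner \<Omega> (H' t) (H t)
          = - L2_inner \<Omega> (E t) (P' t)"
        by (simp add: L2_inner_commute[of \<Omega> "E t" "P' t"])
      have "\<epsilon>\<^sub>0 * \<epsilon>\<^sub>i * (L2_inner \<Omega> (E' t) (E t) + L2_inner \<Omega> (E t) (E' t))
          + \<mu>\<^sub>0 * (L2_inner \<Omega> (H' t) (H t) + L2_inner \<Omega> (H t) (H' t))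
        = 2 * (\<epsilon>\<^sub>0 * \<epsilon>\<^sub>i * L2_inner \<Omega> (E' t) (E t) + \<mu>\<^sub>0 * L2_inner \<Omega> (H' t) (H t))"
        unfolding L2_inner_commute[of \<Omega> "E t" "E' t"] L2_inner_commute[of \<Omega> "H t" "H' t"]
        by (simp add: algebra_simps)
      then have "?D = A * RL_integral \<alpha> ?N' t + 2 * L2_inner \<Omega> (P t) (P' t) - 2 * (\<kappa> * L2_inner \<Omega> (E t) (P' t))"
        unfolding Maxwell L2_inner_commute[of \<Omega> "P' t" "P t"] by simp
      also have "\<dots> = A * (RL_integral \<alpha> ?N' t - 2 * L2_inner \<Omega> (P' t) (w t))"
        using A_w[OF t' mem(4)[OF t']] by (simp add: L2_inner_commute[of \<Omega> "P' t" "w t"] algebra_simps)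
      also have "\<dots> \<le> A * (- eta \<alpha> t * L2_inner \<Omega> (w t) (w t))"
      proof (rule mult_left_mono)
        have "RL_integral \<alpha> ?N' t
            \<le> 2 * RL_integral \<alpha> (\<lambda>s. L2_inner \<Omega> (w' s) (w t)) t - eta \<alpha> t * L2_inner \<Omega> (w t) (w t)"
          using order t by (intro L2_fractional_chain_inequality[OF _ _ _ w_C1] w0) auto
        then show "RL_integral \<alpha> ?N' t - 2 * L2_inner \<Omega> (P' t) (w t) \<le> - eta \<alpha> t * L2_inner \<Omega> (w t) (w t)"
          using P'_RL[OF t mem(5)[OF t']] by simp
      qed (use A in simp)
      finally show ?thesis by (simp add: norm_caputo[OF t] L2_norm_power2)
    qed
    ultimately show ?thesis by blast
  qed
  have eta_nonneg: "0 \<le> eta \<alpha> t" for t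
    using Gamma_real_pos[OF order(1)] by (simp add: eta_def)
  show ?thesis
  proof (intro conjI ballI impI)
    fix t assume t: "t \<in> {0<..<T}"
    obtain D where D: "(?en has_real_derivative D) (at t)" "D + A * eta \<alpha> t * (L2_norm \<Omega> (caputo \<alpha> P' t))\<^sup>2 \<le> 0"
      using dissipation[OF t] by blast
    show "?en differentiable (at t)" using D(1) real_differentiable_def by blast
    show "deriv ?en t + \<tau>\<^sub>0 powr \<alpha> * eta \<alpha> t * (L2_norm \<Omega> (caputo \<alpha> P' t))\<^sup>2 \<le> 0"
      using D(2) DERIV_imp_deriv[OF D(1)] by (simp add: A_def)
  next
    fix t1 t2 assume t12: "t1 \<in> {0..T}" "t2 \<in> {0..T}" "t1 \<ge> t2"
    show "?en t1 \<le> ?en t2"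
    proof (rule DERIV_nonpos_imp_decreasing_open[OF t12(3)])
      show "continuous_on {t2..t1} ?en"
        by (rule continuous_on_subset[OF cont_energy]) (use t12 in auto)
      fix t assume "t2 < t" "t < t1"
      then have "t \<in> {0<..<T}" using t12 by auto
      from dissipation[OF this] obtain D where D: "(?en has_real_derivative D) (at t)"
          "D + A * eta \<alpha> t * (L2_norm \<Omega> (caputo \<alpha> P' t))\<^sup>2 \<le> 0" by blast
      moreover have "0 \<le> A * eta \<alpha> t * (L2_norm \<Omega> (caputo \<alpha> P' t))\<^sup>2"
        using A eta_nonneg[of t] by simp
      ultimately show "\<exists>D. (?en has_real_derivative D) (at t) \<and> D \<le> 0"
        by (intro exI[of _ D]) linarith
    qed
  qed
qed

end
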